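(* Let $1\leq\alpha<2$ and let $S_\alpha$ be the $\alpha$-stable random walk on $\mathbb{Z}^2$. Let $\mathcal{A}\subset\mathbb{Z}^2$ be a radially bounded superlinear set. Then $\mathcal{A}$ is $S_\alpha$-massive if and only if $$\sum_{a\in\mathcal{A}}\frac{1}{\Vert a\Vert_\infty^{2-\alpha}}=\infty.$$
   Context: Let $S$ be the symmetric simple random walk on $\mathbb{Z}^2$, with transition operator $P$. For $0<\alpha<2$, the $\alpha$-stable random walk $S_\alpha$ is the (transient) random walk on $\mathbb{Z}^2$ with transition operator $P_\alpha=I-(I-P)^{\alpha/2}=\sum_{k\geq1}c_kP^k$, where $c_k=(-1)^{k+1}\binom{\alpha/2}{k}\geq0$. A set $B\subset\mathbb{Z}^2$ is $S_\alpha$-massive if for every starting point $x$ the walk started at $x$ hits $B$ with probability $1$. $\Vert\cdot\Vert_\infty$ is the max-norm. A set $\mathcal{A}\subset\mathbb{Z}^2$ is radially bounded if there is $N>0$ such that $\#\{a\in\mathcal{A}:\Vert a\Vert_\infty=r\}\leq N$ for every $r>0$. A radially bounded set $\mathcal{A}$ is superlinear if the set of numbers $\{\Vert x\Vert_\infty:x\in\mathcal{A}\}$, enumerated in increasing order as $a_1<a_2<\dots$, satisfies $a_n\geq a_{n-k}+a_k$ for all $0<k<n$. *)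

theory Defs
  imports "HOL-Probability.Probability" "HOL-Library.Infinite_Set"
begin

type_synonym pt = "int \<times> int"

fun srw_pow :: "nat \<Rightarrow> pt \<Rightarrow> real" where
  "srw_pow 0 z = (if z = (0, 0) then 1 else 0)"
| "srw_pow (Suc k) (a, b) =
     (srw_pow k (a - 1, b) + srw_pow k (a + 1, b) + srw_pow k (a, b - 1) + srw_pow k (a, b + 1)) / 4"

definition stable_coeff :: "real \<Rightarrow> nat \<Rightarrow> real" where
  "stable_coeff \<alpha> k = (-1) ^ (k + 1) * ((\<alpha> / 2) gchoose k)"

text \<open>Step distribution of S_alpha: P_alpha(x,y) = stable_kernel alpha (y - x),
  where P_alpha = sum_{k>=1} c_k P^k.\<close>
definition stable_kernel :: "real \<Rightarrow> pt \<Rightarrow> real" where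
  "stable_kernel \<alpha> z = (\<Sum>k. stable_coeff \<alpha> (Suc k) * srw_pow (Suc k) z)"

definition stable_step :: "real \<Rightarrow> pt pmf" where
  "stable_step \<alpha> = embed_pmf (stable_kernel \<alpha>)"

definition stable_steps :: "real \<Rightarrow> pt stream measure" where
  "stable_steps \<alpha> = stream_space (measure_pmf (stable_step \<alpha>))"

definition walk_pos :: "pt \<Rightarrow> pt stream \<Rightarrow> nat \<Rightarrow> pt" where
  "walk_pos x \<omega> n = (fst x + (\<Sum>i<n. fst (\<omega> !! i)), snd x + (\<Sum>i<n. snd (\<omega> !! i)))"

definition stable_massive :: "real \<Rightarrow> pt set \<Rightarrow> bool" where
  "stable_massive \<alpha> B \<longleftrightarrow>
     (\<forall>x. AE \<omega> in stable_steps \<alpha>. \<exists>n. walk_pos x \<omega> n \<in> B)"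

definition maxnorm :: "pt \<Rightarrow> nat" where
  "maxnorm a = nat (max \<bar>fst a\<bar> \<bar>snd a\<bar>)"

definition radially_bounded :: "pt set \<Rightarrow> bool" where
  "radially_bounded A \<longleftrightarrow> (\<exists>N>0. \<forall>r>0. card {a \<in> A. maxnorm a = r} \<le> N)"

text \<open>a_n (1-indexed): the n-th smallest element of the set of norms of A.\<close>
definition norm_seq :: "pt set \<Rightarrow> nat \<Rightarrow> nat" where
  "norm_seq A n = (if finite (maxnorm ` A) then sorted_list_of_set (maxnorm ` A) ! (n - 1)
                   else enumerate (maxnorm ` A) (n - 1))"

definition superlinear :: "pt set \<Rightarrow> bool" where
  "superlinear A \<longleftrightarrow> radially_bounded A \<and>
     (\<forall>n k. 0 < k \<and> k < n \<and> (finite (maxnorm ` A) \<longrightarrow> n \<le> card (maxnorm ` A)) \<longrightarrow>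
        norm_seq A n \<ge> norm_seq A (n - k) + norm_seq A k)"

end

theory Submission
  imports Defs
begin

text \<open>
  The Green function of \<open>S_\<alpha>\<close> is \<open>(I - P) powr (-\<alpha>/2) = \<Sum>k. d_k P^k\<close>, where
  \<open>d_k = (-1)^k (-\<alpha>/2 gchoose k)\<close> is of order \<open>k powr (\<alpha>/2 - 1)\<close>. In the coordinates
  \<open>(a + b, a - b)\<close> the planar walk splits into two independent one-dimensional ones, which gives
  elementary heat kernel bounds and hence a Green function comparable to \<open>\<parallel>z\<parallel> powr (\<alpha> - 2)\<close>.
  If \<open>A\<close> is hit from everywhere, the expected number of visits to \<open>A\<close> is infinite, so the series
  diverges. Conversely, superlinearity gives \<open>a_n - a_m \<ge> a_(n-m)\<close>, so the potential of a finite
  piece \<open>B\<close> of \<open>A\<close> is, on \<open>B\<close>, at most a constant times its value at any fixed point, once \<open>B\<close> is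
  large. By the maximum principle the hitting probabilities are then bounded below uniformly in the
  starting point, and the Markov property improves this bound to 1.
\<close>

section \<open>Binomial coefficients of the Green function\<close>

text \<open>The heat kernel bounds need neither Fourier analysis nor a local limit theorem: the
  kernel on the line is a binomial coefficient divided by 2^k, so the quotient of its values at j +
  2 and j is explicit, and decay and lower bounds are read off from it. The obstacle is parity: P^k
  vanishes on half of the lattice, so the lower bound concerns the sum of two consecutive powers,
  which suffices because d_k is decreasing.

  The Green function is never identified with an expected number of visits. Its link to the walk is
  the renewal equation g = indicator {0} + P_\<alpha> g, that is, (1 - x)^(\<alpha>/2) (1 -
  x)^(-\<alpha>/2) = 1 read on coefficients. Together with the one-step equation for hitting
  probabilities it serves both directions.

  In the converse the finite piece of A may depend on the starting point, yet the bound must not.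
  This works because the potential at that point and its maximum over the piece are both compared
  with the same partial sum of the series, which cancels.\<close>

definition green_coeff :: "real \<Rightarrow> nat \<Rightarrow> real" where
  "green_coeff b k = (-1) ^ k * ((- b) gchoose k)"

lemma green_coeff_0 [simp]: "green_coeff b 0 = 1"
  by (simp add: green_coeff_def)

lemma green_coeff_Suc: "real (Suc k) * green_coeff b (Suc k) = (real k + b) * green_coeff b k"
proof -
  have "real (Suc k) * green_coeff b (Suc k) = - ((-1) ^ k) * (real (Suc k) * (- b gchoose Suc k))"
    unfolding green_coeff_def power_Suc by (simp del: of_nat_Suc add: mult_ac)
  also have "real (Suc k) * (- b gchoose Suc k) = (- b - real k) * (- b gchoose k)"
    using gbinomial_mult_1[of "- b" k] by (simp add: algebra_simps)
  also have "- ((-1) ^ k) * \<dots> = (real k + b) * green_coeff b k"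
    by (simp add: green_coeff_def algebra_simps)
  finally show ?thesis .
qed

lemma green_coeff_Suc': "green_coeff b (Suc k) = (real k + b) / real (Suc k) * green_coeff b k"
  using green_coeff_Suc[of k b] by (simp add: field_simps)

lemma green_coeff_pos: "0 < b \<Longrightarrow> 0 < green_coeff b k"
  by (induction k) (auto simp: green_coeff_Suc')

lemma green_coeff_antimono:
  assumes "0 < b" "b \<le> 1" "k \<le> l"
  shows "green_coeff b l \<le> green_coeff b k"
  using \<open>k \<le> l\<close>
proof (induction rule: dec_induct)
  case (step n)
  have "(real n + b) / real (Suc n) * green_coeff b n \<le> 1 * green_coeff b n"
    using assms green_coeff_pos[of b n] by (intro mult_right_mono) (auto simp: field_simps)
  then show ?case
    using step green_coeff_Suc'[of b n] by simp
qed simp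

text \<open>These are the coefficients of (1 - x)^(-b - 1). What matters is that d_0 + ... + d_m is
  of order m d_m: this controls the times k < m in the Green series.\<close>

lemma green_coeff_sum:
  assumes "0 < b"
  shows "(\<Sum>k\<le>m. green_coeff b k) = green_coeff b m * (real m + b) / b"
proof (induction m)
  case (Suc m)
  have "(\<Sum>k\<le>Suc m. green_coeff b k) = real (Suc m) * green_coeff b (Suc m) / b + green_coeff b (Suc m)"
    using Suc green_coeff_Suc[of m b] by (simp add: mult.commute)
  then show ?case
    using assms by (simp add: field_simps)
qed (use assms in simp)

text \<open>Concavity of x powr p, obtained from Young's inequality with second factor 1. It
  compares the exact quotient of consecutive coefficients with a quotient of powers.\<close>

lemma powr_Bernoulli_le:
  fixes x p :: real
  assumes "0 \<le> x" "0 < p" "p < 1"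
  shows "x powr p \<le> 1 + p * (x - 1)"
proof (cases "x = 0")
  case False
  then have "x powr p * 1 powr (1 - p) \<le> p * x + (1 - p) * 1"
    using assms by (intro Youngs_inequality_0) auto
  then show ?thesis by (simp add: algebra_simps)
qed (use assms in auto)

text \<open>The Bernoulli bound at n/(n + 1) says that d_n / n powr (b - 1) does not decrease in n,
  and this quantity equals b at n = 1.\<close>

lemma green_coeff_ge:
  assumes b: "0 < b" "b < 1" and "1 \<le> k"
  shows "b * real k powr (b - 1) \<le> green_coeff b k"
  using \<open>1 \<le> k\<close>
proof (induction rule: dec_induct)
  case base
  then show ?case by (simp add: green_coeff_def)
next
  case (step n)
  have n: "real n > 0" using step by simp
  have *: "(real n / real (Suc n)) powr (1 - b) \<le> 1 + (1 - b) * (real n / real (Suc n) - 1)"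
    using b by (intro powr_Bernoulli_le) auto
  also have "\<dots> = (real n + b) / real (Suc n)"
    by (simp add: field_simps)
  finally have *: "(real n / real (Suc n)) powr (1 - b) \<le> (real n + b) / real (Suc n)" .
  have "real (Suc n) powr (b - 1) = (real n / real (Suc n)) powr (1 - b) * real n powr (b - 1)"
    using n powr_add[of "real n" "1 - b" "b - 1"] powr_minus_divide[of "real (Suc n)" "1 - b"]
    by (simp add: powr_divide)
  then have "b * real (Suc n) powr (b - 1) = (real n / real (Suc n)) powr (1 - b) * (b * real n powr (b - 1))"
    by simp
  also have "\<dots> \<le> (real n + b) / real (Suc n) * green_coeff b n"
    using step b by (intro mult_mono *) (auto intro: less_imp_le)
  finally show ?case by (simp add: green_coeff_Suc')
qed

lemma green_coeff_le:
  assumes b: "0 < b" "b < 1" and "1 \<le> k"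
  shows "green_coeff b k \<le> real k powr (b - 1)"
proof -
  \<comment> \<open>The shifted argument makes the claim an equality at k = 0 and lets the Bernoulli
    bound produce the quotient (n + b)/(n + 1) directly. As b < 1, the shifted argument is at least
    k, so passing to k only enlarges the right side.\<close>
  have *: "green_coeff b k \<le> ((real k + b) / b) powr (b - 1)"
  proof (induction k)
    case 0
    then show ?case using b by simp
  next
    case (Suc n)
    have p: "real n + b > 0" using b by simp
    have "((real n + b + 1) / (real n + b)) powr (1 - b) \<le> 1 + (1 - b) * ((real n + b + 1) / (real n + b) - 1)"
      using b by (intro powr_Bernoulli_le) auto
    also have "\<dots> = real (Suc n) / (real n + b)"
      using p by (simp add: field_simps)
    finally have "((real n + b + 1) / (real n + b)) powr (1 - b) \<le> real (Suc n) / (real n + b)" .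
    then have "inverse (real (Suc n) / (real n + b)) \<le> inverse (((real n + b + 1) / (real n + b)) powr (1 - b))"
      using p by (intro le_imp_inverse_le) auto
    then have **: "(real n + b) / real (Suc n) \<le> ((real n + b + 1) / (real n + b)) powr (b - 1)"
      using powr_minus[of "(real n + b + 1) / (real n + b)" "1 - b"] by simp
    have "green_coeff b (Suc n) \<le> ((real n + b + 1) / (real n + b)) powr (b - 1) * ((real n + b) / b) powr (b - 1)"
      unfolding green_coeff_Suc'
      using ** Suc green_coeff_pos[OF b(1), of n] by (intro mult_mono) auto
    also have "\<dots> = ((real n + b + 1) / (real n + b) * ((real n + b) / b)) powr (b - 1)"
      using b p by (subst powr_mult) auto
    also have "(real n + b + 1) / (real n + b) * ((real n + b) / b) = (real (Suc n) + b) / b"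
      using p by simp
    finally show ?case .
  qed
  also have "((real k + b) / b) powr (b - 1) \<le> real k powr (b - 1)"
  proof (intro powr_mono2')
    have "real k * b \<le> real k * 1" using b by (intro mult_left_mono) auto
    then show "real k \<le> (real k + b) / b" using b by (simp add: field_simps)
  qed (use assms in auto)
  finally show ?thesis .
qed

lemma green_coeff_tendsto_0:
  assumes b: "0 < b" "b < 1"
  shows "green_coeff b \<longlonglongrightarrow> 0"
proof (rule tendsto_sandwich[where f = "\<lambda>_. 0" and h = "\<lambda>k. real k powr (b - 1)"])
  show "(\<lambda>k. real k powr (b - 1)) \<longlonglongrightarrow> 0"
    using b by (intro tendsto_neg_powr filterlim_real_sequentially) auto
  show "\<forall>\<^sub>F k in sequentially. green_coeff b k \<le> real k powr (b - 1)"
    using eventually_ge_at_top[of 1] by eventually_elim (use green_coeff_le[OF b] in auto)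
  show "\<forall>\<^sub>F k in sequentially. 0 \<le> green_coeff b k"
    using green_coeff_pos[OF b(1)] by (intro always_eventually allI less_imp_le)
qed simp

text \<open>Telescoping, since d_k - d_(k+1) = (1 - b) d_k / (k + 1). As the planar heat kernel at
  time k is O(1/(k + 1)), this controls the tails of the Green series; with m = 0 it also gives
  total mass 1 for the step coefficients.\<close>

lemma green_coeff_tail_sums:
  assumes b: "0 < b" "b < 1"
  shows "(\<lambda>k. green_coeff b (m + k) / real (m + k + 1)) sums (green_coeff b m / (1 - b))"
proof -
  have "(\<lambda>k. green_coeff b (m + k)) \<longlonglongrightarrow> 0"
    using LIMSEQ_ignore_initial_segment[OF green_coeff_tendsto_0[OF b], of m] by (simp add: add.commute)
  then have "(\<lambda>k. green_coeff b (m + k) - green_coeff b (m + Suc k)) sums (green_coeff b (m + 0) - 0)"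
    by (rule telescope_sums')
  then have "(\<lambda>k. (green_coeff b (m + k) - green_coeff b (m + Suc k)) / (1 - b)) sums (green_coeff b m / (1 - b))"
    using sums_divide by fastforce
  moreover have "(green_coeff b (m + k) - green_coeff b (m + Suc k)) / (1 - b) = green_coeff b (m + k) / real (m + k + 1)" for k
    using b green_coeff_Suc'[of b "m + k"] by (simp add: field_simps)
  ultimately show ?thesis by simp
qed

text \<open>The derivative of 1 - (1 - x)^(\<alpha>/2) is \<alpha>/2 (1 - x)^(\<alpha>/2 - 1), so
  the step coefficients inherit sign and summability from \<open>green_coeff\<close> with parameter
  1 - \<alpha>/2.\<close>

lemma stable_coeff_Suc:
  "stable_coeff \<alpha> (Suc n) = \<alpha> / 2 * green_coeff (1 - \<alpha> / 2) n / real (Suc n)"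
proof (induction n)
  case 0
  then show ?case by (simp add: stable_coeff_def)
next
  case (Suc n)
  have "real (Suc (Suc n)) * stable_coeff \<alpha> (Suc (Suc n)) =
      (-1) ^ Suc n * (real (Suc (Suc n)) * (\<alpha> / 2 gchoose Suc (Suc n)))"
    by (simp del: of_nat_Suc add: stable_coeff_def mult_ac)
  also have "real (Suc (Suc n)) * (\<alpha> / 2 gchoose Suc (Suc n)) = (\<alpha> / 2 - real (Suc n)) * (\<alpha> / 2 gchoose Suc n)"
    using gbinomial_mult_1[of "\<alpha> / 2" "Suc n"] by (simp add: algebra_simps)
  also have "(-1) ^ Suc n * \<dots> = (real (Suc n) - \<alpha> / 2) * stable_coeff \<alpha> (Suc n)"
    by (simp add: stable_coeff_def algebra_simps)
  also have "\<dots> = \<alpha> / 2 * green_coeff (1 - \<alpha> / 2) (Suc n)"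
    unfolding Suc green_coeff_Suc' by (simp add: mult_ac)
  finally show ?case by (simp only: eq_divide_eq) (simp add: mult.commute)
qed

lemma stable_coeff_Suc_pos: "0 < \<alpha> \<Longrightarrow> \<alpha> < 2 \<Longrightarrow> 0 < stable_coeff \<alpha> (Suc n)"
  using green_coeff_pos[of "1 - \<alpha> / 2" n] by (simp add: stable_coeff_Suc)

lemma stable_coeff_sums:
  assumes "0 < \<alpha>" "\<alpha> < 2"
  shows "(\<lambda>n. stable_coeff \<alpha> (Suc n)) sums 1"
proof -
  have "(\<lambda>n. \<alpha> / 2 * (green_coeff (1 - \<alpha> / 2) (0 + n) / real (0 + n + 1))) sums
      (\<alpha> / 2 * (green_coeff (1 - \<alpha> / 2) 0 / (1 - (1 - \<alpha> / 2))))"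
    using assms by (intro sums_mult green_coeff_tail_sums) auto
  then show ?thesis using assms by (simp add: stable_coeff_Suc)
qed

text \<open>Coefficient of x^(n + 1) in (1 - x)^(\<alpha>/2) (1 - x)^(-\<alpha>/2) = 1. The step
  coefficients are those of the first factor with opposite sign, so the term k = 0 of the
  Vandermonde sum becomes the right side.\<close>

lemma green_coeff_convolution:
  "(\<Sum>j\<le>n. stable_coeff \<alpha> (Suc j) * green_coeff (\<alpha> / 2) (n - j)) = green_coeff (\<alpha> / 2) (Suc n)"
proof -
  let ?b = "\<alpha> / 2"
  have "(\<Sum>k\<le>Suc n. (?b gchoose k) * ((- ?b) gchoose (Suc n - k))) = 0"
    using gbinomial_Vandermonde[of ?b "- ?b" "Suc n"] by (simp del: sum.atMost_Suc add: atMost_atLeast0)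
  then have "0 = (-1) ^ Suc n * (\<Sum>k\<le>Suc n. (?b gchoose k) * ((- ?b) gchoose (Suc n - k)))"
    by (simp del: sum.atMost_Suc)
  also have "\<dots> = (\<Sum>k\<le>Suc n. ((-1) ^ k * (?b gchoose k)) * green_coeff ?b (Suc n - k))"
    unfolding sum_distrib_left
  proof (rule sum.cong)
    fix k assume "k \<in> {..Suc n}"
    then have "(-1 :: real) ^ Suc n = (-1) ^ k * (-1) ^ (Suc n - k)"
      by (subst power_add[symmetric]) auto
    then show "(-1) ^ Suc n * ((?b gchoose k) * ((- ?b) gchoose (Suc n - k))) =
        (-1) ^ k * (?b gchoose k) * green_coeff ?b (Suc n - k)"
      by (simp add: green_coeff_def)
  qed simp
  also have "\<dots> = green_coeff ?b (Suc n) - (\<Sum>j\<le>n. stable_coeff \<alpha> (Suc j) * green_coeff ?b (n - j))"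
    by (subst sum.atMost_Suc_shift) (simp add: stable_coeff_def sum_negf)
  finally show ?thesis by simp
qed

section \<open>Simple random walk on the line\<close>

fun srw1_pow :: "nat \<Rightarrow> int \<Rightarrow> real" where
  "srw1_pow 0 j = (if j = 0 then 1 else 0)"
| "srw1_pow (Suc k) j = (srw1_pow k (j - 1) + srw1_pow k (j + 1)) / 2"

text \<open>The four steps move (a + b, a - b) by the four pairs of signs, each with probability
  1/4.\<close>

lemma srw_pow_eq: "srw_pow k (a, b) = srw1_pow k (a + b) * srw1_pow k (a - b)"
proof (induction k arbitrary: a b)
  case (Suc k)
  show ?case
    by (simp add: Suc algebra_simps)
qed auto

lemma srw1_pow_nonneg: "0 \<le> srw1_pow k j"
  by (induction k arbitrary: j) auto

lemma srw1_pow_minus: "srw1_pow k (- j) = srw1_pow k j"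
proof (induction k arbitrary: j)
  case (Suc k)
  show ?case using Suc[of "j + 1"] Suc[of "j - 1"] by simp
qed auto

lemma srw1_pow_abs: "srw1_pow k \<bar>j\<bar> = srw1_pow k j"
  by (cases "j \<ge> 0") (auto simp: srw1_pow_minus)

lemma srw1_pow_eq_0: "int k < j \<Longrightarrow> srw1_pow k j = 0"
  by (induction k arbitrary: j) auto

text \<open>Quotient of neighbouring binomial coefficients. The form without division holds for
  every integer j, also off the support and for the wrong parity.\<close>

lemma srw1_pow_ratio:
  "(real k + real_of_int j + 2) * srw1_pow k (j + 2) = (real k - real_of_int j) * srw1_pow k j"
proof (induction k arbitrary: j)
  case (Suc k)
  have 1: "(real k + real_of_int j + 3) * srw1_pow k (j + 3) = (real k - real_of_int j - 1) * srw1_pow k (j + 1)"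
    using Suc[of "j + 1"] by (simp add: algebra_simps)
  have 2: "(real k + real_of_int j + 1) * srw1_pow k (j + 1) = (real k - real_of_int j + 1) * srw1_pow k (j - 1)"
    using Suc[of "j - 1"] by (simp add: algebra_simps)
  have "(real (Suc k) + real_of_int j + 2) * srw1_pow (Suc k) (j + 2) =
      ((real k + real_of_int j + 3) * srw1_pow k (j + 1) + (real k + real_of_int j + 3) * srw1_pow k (j + 3)) / 2"
    by (simp add: algebra_simps add_divide_distrib)
  also have "\<dots> = ((real k + real_of_int j + 1) * srw1_pow k (j + 1) + (real k - real_of_int j + 1) * srw1_pow k (j + 1)) / 2"
    unfolding 1 by (simp add: algebra_simps)
  also have "\<dots> = (real (Suc k) - real_of_int j) * srw1_pow (Suc k) j"
    unfolding 2 by (simp add: algebra_simps add_divide_distrib diff_divide_distrib)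
  finally show ?case .
qed auto

lemma srw1_pow_decreasing:
  assumes "0 \<le> j"
  shows "srw1_pow k (j + 2) \<le> srw1_pow k j"
proof -
  have p: "0 < real k + real_of_int j + 2" using assms by simp
  have "(real k + real_of_int j + 2) * srw1_pow k (j + 2) \<le> (real k + real_of_int j + 2) * srw1_pow k j"
    unfolding srw1_pow_ratio using assms srw1_pow_nonneg by (intro mult_right_mono) auto
  then show ?thesis using p by simp
qed

lemma srw1_pow_even_le: "srw1_pow k (2 * int s) \<le> srw1_pow k 0"
proof (induction s)
  case (Suc s)
  have "srw1_pow k (2 * int s + 2) \<le> srw1_pow k (2 * int s)"
    by (rule srw1_pow_decreasing) simp
  then show ?case using Suc by (simp add: algebra_simps)
qed simp

lemma srw1_pow_parity: "odd (int k + j) \<Longrightarrow> srw1_pow k j = 0"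
  by (induction k arbitrary: j) auto

lemma srw1_pow_0_Suc2:
  "srw1_pow (2 * Suc m) 0 = srw1_pow (2 * m) 0 * (2 * real m + 1) / (2 * real m + 2)"
proof -
  have "srw1_pow (2 * Suc m) 0 = (srw1_pow (2 * m) (- 2) + 2 * srw1_pow (2 * m) 0 + srw1_pow (2 * m) 2) / 4"
    by (simp add: add_divide_distrib)
  also have "srw1_pow (2 * m) (- 2) = srw1_pow (2 * m) 2"
    by (rule srw1_pow_minus)
  also have "srw1_pow (2 * m) 2 = 2 * real m / (2 * real m + 2) * srw1_pow (2 * m) 0"
    using srw1_pow_ratio[of "2 * m" 0] by (simp add: field_simps)
  also have "(2 * real m / (2 * real m + 2) * x + 2 * x + 2 * real m / (2 * real m + 2) * x) / 4
      = x * (2 * real m + 1) / (2 * real m + 2)" for x :: real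
    by (simp add: divide_simps) (simp add: algebra_simps)
  finally show ?thesis .
qed

text \<open>Wallis-type bound: by the two-step recursion the left side is nonincreasing in m,
  because (2m + 1)(2m + 3) \<le> (2m + 2)^2. The lower bound is the same argument, with 4m + 1
  chosen so that the product is nondecreasing.\<close>

lemma srw1_pow_0_upper: "(srw1_pow (2 * m) 0)\<^sup>2 * (2 * real m + 1) \<le> 1"
proof (induction m)
  case (Suc m)
  have "(2 * real m + 1) * (2 * real m + 3) \<le> (2 * real m + 2)\<^sup>2"
    by (simp add: power2_eq_square algebra_simps)
  then have *: "(2 * real m + 1) * (2 * real m + 3) / (2 * real m + 2)\<^sup>2 \<le> 1"
    by simp
  have "(srw1_pow (2 * Suc m) 0)\<^sup>2 * (2 * real (Suc m) + 1) =
      ((srw1_pow (2 * m) 0)\<^sup>2 * (2 * real m + 1)) * ((2 * real m + 1) * (2 * real m + 3) / (2 * real m + 2)\<^sup>2)"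
    unfolding srw1_pow_0_Suc2 by (simp add: power2_eq_square field_simps)
  also have "\<dots> \<le> 1 * 1"
    by (intro mult_mono Suc *) auto
  finally show ?case by simp
qed simp

lemma srw1_pow_0_lower: "1 \<le> (srw1_pow (2 * m) 0)\<^sup>2 * (4 * real m + 1)"
proof (induction m)
  case (Suc m)
  have "(2 * real m + 2)\<^sup>2 * (4 * real m + 1) \<le> (2 * real m + 1)\<^sup>2 * (4 * real m + 5)"
    by (simp add: power2_eq_square algebra_simps)
  then have *: "4 * real m + 1 \<le> ((2 * real m + 1) / (2 * real m + 2))\<^sup>2 * (4 * real m + 5)"
    by (simp add: field_simps)
  have "1 \<le> (srw1_pow (2 * m) 0)\<^sup>2 * (4 * real m + 1)" by (rule Suc)
  also have "\<dots> \<le> (srw1_pow (2 * m) 0)\<^sup>2 * (((2 * real m + 1) / (2 * real m + 2))\<^sup>2 * (4 * real m + 5))"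
    by (intro mult_left_mono *) auto
  also have "\<dots> = (srw1_pow (2 * Suc m) 0)\<^sup>2 * (4 * real (Suc m) + 1)"
    unfolding srw1_pow_0_Suc2 times_divide_eq_right[symmetric] power_mult_distrib
    by (simp del: times_divide_eq_right)
  finally show ?case .
qed simp

lemma srw1_pow_even_sq_le:
  assumes "even k"
  shows "(srw1_pow k j)\<^sup>2 \<le> 1 / (real k + 1)"
proof (cases "even j")
  case False
  then show ?thesis using srw1_pow_parity[of k j] assms by simp
next
  case True
  then have "even \<bar>j\<bar>" by simp
  then obtain i where i: "\<bar>j\<bar> = 2 * i" by (metis evenE)
  then have "i = int (nat i)" by simp
  then have "srw1_pow k j \<le> srw1_pow k 0"
    using srw1_pow_even_le[of k "nat i"] i srw1_pow_abs[of k j] by simp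
  then have "(srw1_pow k j)\<^sup>2 \<le> (srw1_pow k 0)\<^sup>2"
    using srw1_pow_nonneg by (intro power_mono) auto
  also have "\<dots> \<le> 1 / (real k + 1)"
    using assms srw1_pow_0_upper by (auto elim!: evenE simp: field_simps)
  finally show ?thesis .
qed

text \<open>At an odd time the kernel averages two values of the preceding even time, and convexity
  of the square transfers the bound; the 2 absorbs 1/k \<le> 2/(k + 1).\<close>

lemma srw1_pow_sq_le: "(srw1_pow k j)\<^sup>2 \<le> 2 / (real k + 1)"
proof (cases "even k")
  case True
  have "1 / (real k + 1) \<le> 2 / (real k + 1)" by (intro divide_right_mono) auto
  then show ?thesis using srw1_pow_even_sq_le[OF True, of j] by linarith
next
  case False
  then obtain l where k: "k = Suc l" and l: "even l" by (auto elim: oddE)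
  define x y where "x = srw1_pow l (j - 1)" and "y = srw1_pow l (j + 1)"
  have "((x + y) / 2)\<^sup>2 \<le> (x\<^sup>2 + y\<^sup>2) / 2"
    using zero_le_power2[of "x - y"] by (simp add: power2_eq_square field_simps)
  also have "\<dots> \<le> (1 / (real l + 1) + 1 / (real l + 1)) / 2"
    unfolding x_def y_def by (intro divide_right_mono add_mono srw1_pow_even_sq_le l) auto
  also have "\<dots> \<le> 2 / (real k + 1)" by (simp add: k field_simps)
  finally show ?thesis by (simp add: k x_def y_def)
qed

text \<open>An elementary replacement for Gaussian decay. Once n (n - 2) \<ge> 2k, the quotient
  formula shows that n^2 times the kernel does not grow from n - 2 to n. Below that threshold n^2
  \<le> 4k on the support, and the uniform bound is enough.\<close>

lemma srw1_pow_le_quadratic_nat: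
  "(real n)\<^sup>2 * srw1_pow k (int n) \<le> 4 * real k * sqrt (2 / (real k + 1))"
proof (induction n rule: less_induct)
  case (less n)
  show ?case
  proof (cases "int n * (int n - 2) \<ge> 2 * int k \<and> n \<ge> 2")
    case True
    then have n2: "n \<ge> 2" and "real_of_int (2 * int k) \<le> real_of_int (int n * (int n - 2))"
      by (auto simp only: of_int_le_iff)
    then have nk: "2 * real k \<le> real n * (real n - 2)" by simp
    define j where "j = real n"
    have q: "(real k + j) * srw1_pow k (int n) = (real k - j + 2) * srw1_pow k (int (n - 2))"
      using srw1_pow_ratio[of k "int n - 2"] n2 by (simp add: of_nat_diff j_def)
    have j: "j \<ge> 2" using n2 by (simp add: j_def)
    \<comment> \<open>This product is exactly the difference of the two sides of
      \<open>le\<close>.\<close>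
    have "0 \<le> 2 * ((j - 1) * (j * (j - 2) - 2 * real k))"
      using j nk by (simp add: j_def)
    then have le: "j\<^sup>2 * (real k - j + 2) \<le> (j - 2)\<^sup>2 * (real k + j)"
      by (simp add: power2_eq_square algebra_simps)
    have "(real k + j) * (j\<^sup>2 * srw1_pow k (int n)) = j\<^sup>2 * (real k - j + 2) * srw1_pow k (int (n - 2))"
      using q by (simp add: mult_ac)
    also have "\<dots> \<le> (j - 2)\<^sup>2 * (real k + j) * srw1_pow k (int (n - 2))"
      using le srw1_pow_nonneg by (rule mult_right_mono)
    also have "\<dots> = (real k + j) * ((real (n - 2))\<^sup>2 * srw1_pow k (int (n - 2)))"
      using n2 by (simp add: j_def of_nat_diff)
    finally have "j\<^sup>2 * srw1_pow k (int n) \<le> (real (n - 2))\<^sup>2 * srw1_pow k (int (n - 2))"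
      using j by (simp del: of_nat_diff add: mult_le_cancel_left)
    also have "\<dots> \<le> 4 * real k * sqrt (2 / (real k + 1))"
      using n2 by (intro less) auto
    finally show ?thesis by (simp add: j_def)
  next
    case False
    show ?thesis
    proof (cases "n \<le> k")
      case True
      have "(int n)\<^sup>2 \<le> 4 * int k"
      proof (cases "n \<ge> 2")
        case True
        then have "int n * int n < 2 * int k + 2 * int n" using False by (simp add: algebra_simps)
        then show ?thesis using \<open>n \<le> k\<close> by (simp add: power2_eq_square)
      next
        case False
        then have "n = 0 \<or> n = 1" by auto
        then show ?thesis using True by auto
      qed
      then have "real_of_int ((int n)\<^sup>2) \<le> real_of_int (4 * int k)" by (simp only: of_int_le_iff)
      then have "(real n)\<^sup>2 \<le> 4 * real k" by simp
      moreover have "srw1_pow k (int n) \<le> sqrt (2 / (real k + 1))"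
        using srw1_pow_sq_le by (rule real_le_rsqrt)
      ultimately show ?thesis using srw1_pow_nonneg by (intro mult_mono) auto
    next
      case False
      then show ?thesis using srw1_pow_eq_0[of k "int n"] by simp
    qed
  qed
qed

text \<open>Each move from j to j + 2 costs a factor 1 - (2j + 2)/(k + j + 2). The product is at
  least 1 minus the sum of the losses, and (j + 2)^2 - j^2 = 2 (2j + 2) makes the majorants (2j +
  2)/k add up to (2s)^2/(2k).\<close>

lemma srw1_pow_lower:
  assumes "0 < k"
  shows "srw1_pow k 0 * (1 - (real (2 * s))\<^sup>2 / (2 * real k)) \<le> srw1_pow k (2 * int s)"
proof (induction s)
  case (Suc s)
  define j where "j = real (2 * s)"
  have j: "0 \<le> j" by (simp add: j_def)
  have q: "(real k + j + 2) * srw1_pow k (2 * int (Suc s)) = (real k - j) * srw1_pow k (2 * int s)"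
    using srw1_pow_ratio[of k "2 * int s"] by (simp add: j_def algebra_simps)
  have J: "real (2 * Suc s) = j + 2" by (simp add: j_def)
  show ?case
  proof (cases "j\<^sup>2 \<le> 2 * real k \<and> j \<le> real k")
    case True
    define x where "x = j\<^sup>2 / (2 * real k)"
    define y where "y = (2 * j + 2) / (real k + j + 2)"
    have x: "0 \<le> x" "x \<le> 1" using True assms by (auto simp: x_def)
    have y: "0 \<le> y" "y \<le> (2 * j + 2) / real k" using j assms by (auto simp: y_def intro!: divide_left_mono)
    have "(1 - (j + 2)\<^sup>2 / (2 * real k)) = 1 - x - (2 * j + 2) / real k"
      using assms by (simp add: x_def power2_eq_square field_simps)
    also have "\<dots> \<le> 1 - x - y" using y by simp
    also have "\<dots> \<le> (1 - x) * (1 - y)" using x y by (simp add: algebra_simps)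
    finally have *: "1 - (j + 2)\<^sup>2 / (2 * real k) \<le> (1 - x) * (1 - y)" .
    have "y \<le> 1" using True j by (simp add: y_def)
    have "srw1_pow k 0 * (1 - (j + 2)\<^sup>2 / (2 * real k)) \<le> srw1_pow k 0 * ((1 - x) * (1 - y))"
      using * srw1_pow_nonneg by (rule mult_left_mono)
    also have "\<dots> = (srw1_pow k 0 * (1 - x)) * (1 - y)" by simp
    also have "\<dots> \<le> srw1_pow k (2 * int s) * (1 - y)"
      using Suc \<open>y \<le> 1\<close> by (intro mult_right_mono) (auto simp: x_def j_def)
    also have "\<dots> = srw1_pow k (2 * int (Suc s))"
      using q j by (simp add: y_def field_simps)
    finally show ?thesis by (simp only: J)
  next
    \<comment> \<open>The factors need not be nonnegative here, but then (j + 2)^2 \<ge> 2k and the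
      claimed lower bound is nonpositive.\<close>
    case False
    have "2 * real k \<le> (j + 2)\<^sup>2"
    proof (cases "j\<^sup>2 \<le> 2 * real k")
      case True
      then have "real k < j" using False by simp
      have "(j + 2)\<^sup>2 = j * j + 4 * j + 4" "j * j \<ge> 0" by (auto simp: power2_eq_square algebra_simps)
      then show ?thesis using \<open>real k < j\<close> j by linarith
    next
      case False
      have "j\<^sup>2 \<le> (j + 2)\<^sup>2" using j by (intro power_mono) auto
      then show ?thesis using False by linarith
    qed
    then have "1 - (j + 2)\<^sup>2 / (2 * real k) \<le> 0" using assms by simp
    then have "srw1_pow k 0 * (1 - (j + 2)\<^sup>2 / (2 * real k)) \<le> 0"
      using srw1_pow_nonneg by (rule mult_nonneg_nonpos[OF _ , rotated])
    then show ?thesis using srw1_pow_nonneg[of k "2 * int (Suc s)"] by (simp only: J)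
  qed
qed simp

lemma srw1_pow_sq_ge:
  assumes "even k" "0 < k" "even j" "j\<^sup>2 \<le> int k"
  shows "1 / (4 * (2 * real k + 1)) \<le> (srw1_pow k j)\<^sup>2"
proof -
  obtain m where m: "k = 2 * m" using assms by (auto elim: evenE)
  obtain i where i: "\<bar>j\<bar> = 2 * i" using \<open>even j\<close> by (metis abs_dvd_iff dvd_abs_iff evenE)
  have "\<bar>j\<bar> = 2 * int (nat i)" using i by simp
  then obtain s where s: "\<bar>j\<bar> = 2 * int s" by blast
  have "j\<^sup>2 = (2 * int s)\<^sup>2" using s power2_abs[of j] by simp
  then have "real_of_int ((2 * int s)\<^sup>2) \<le> real_of_int (int k)"
    using assms(4) by (simp only: of_int_le_iff)
  then have "(real (2 * s))\<^sup>2 \<le> real k" by simp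
  then have "1 / 2 \<le> 1 - (real (2 * s))\<^sup>2 / (2 * real k)"
    using assms by (simp add: field_simps)
  then have "srw1_pow k 0 * (1 / 2) \<le> srw1_pow k 0 * (1 - (real (2 * s))\<^sup>2 / (2 * real k))"
    using srw1_pow_nonneg by (rule mult_left_mono)
  also have "\<dots> \<le> srw1_pow k \<bar>j\<bar>"
    using srw1_pow_lower[OF assms(2)] s by simp
  finally have "srw1_pow k 0 * (1 / 2) \<le> srw1_pow k j"
    by (simp add: srw1_pow_abs)
  then have "(srw1_pow k 0 * (1 / 2))\<^sup>2 \<le> (srw1_pow k j)\<^sup>2"
    using srw1_pow_nonneg by (intro power_mono) auto
  moreover have "1 / (4 * (2 * real k + 1)) \<le> (srw1_pow k 0 * (1 / 2))\<^sup>2"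
    using srw1_pow_0_lower[of m] m by (simp add: power_divide field_simps)
  ultimately show ?thesis by linarith
qed

section \<open>Heat kernel and Green function bounds in the plane\<close>

lemma maxnorm_le_iff: "maxnorm z \<le> n \<longleftrightarrow> \<bar>fst z\<bar> \<le> int n \<and> \<bar>snd z\<bar> \<le> int n"
  by (auto simp: maxnorm_def)

lemma abs_fst_le_maxnorm: "\<bar>fst z\<bar> \<le> int (maxnorm z)"
  and abs_snd_le_maxnorm: "\<bar>snd z\<bar> \<le> int (maxnorm z)"
  using maxnorm_le_iff[of z "maxnorm z"] by auto

lemma srw_pow_nonneg: "0 \<le> srw_pow k z"
  by (cases z) (auto simp: srw_pow_eq srw1_pow_nonneg)

lemma srw_pow_le: "srw_pow k z \<le> 2 / (real k + 1)"
proof -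
  obtain a b where z: "z = (a, b)" by fastforce
  have "srw1_pow k (a + b) * srw1_pow k (a - b) \<le> sqrt (2 / (real k + 1)) * sqrt (2 / (real k + 1))"
    using srw1_pow_sq_le by (intro mult_mono real_le_rsqrt srw1_pow_nonneg) auto
  then show ?thesis by (simp add: z srw_pow_eq)
qed

lemma srw1_pow_le_quadratic:
  "(real_of_int j)\<^sup>2 * srw1_pow k j \<le> 4 * real k * sqrt (2 / (real k + 1))"
  using srw1_pow_le_quadratic_nat[of "nat \<bar>j\<bar>" k] by (simp add: srw1_pow_abs)

text \<open>One of |a + b|, |a - b| equals |a| + |b|, hence is at least the max-norm. That
  coordinate takes the quadratic bound and the other the uniform one; the two square roots multiply
  to 2/(k + 1), which cancels the factor k.\<close>

lemma srw_pow_le_quadratic: "(real (maxnorm z))\<^sup>2 * srw_pow k z \<le> 8"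
proof -
  obtain a b where z: "z = (a, b)" by fastforce
  have *: "(real (maxnorm z))\<^sup>2 * (srw1_pow k i * srw1_pow k j) \<le> 8"
    if "real (maxnorm z) \<le> \<bar>real_of_int i\<bar>" for i j
  proof -
    let ?s = "sqrt (2 / (real k + 1))"
    have "(real (maxnorm z))\<^sup>2 \<le> (real_of_int i)\<^sup>2"
      using that by (simp add: abs_le_square_iff[symmetric])
    then have "(real (maxnorm z))\<^sup>2 * srw1_pow k i \<le> 4 * real k * ?s"
      using srw1_pow_le_quadratic[of i k] srw1_pow_nonneg[of k i]
      by (meson mult_right_mono order_trans)
    then have "((real (maxnorm z))\<^sup>2 * srw1_pow k i) * srw1_pow k j \<le> (4 * real k * ?s) * ?s"
      by (rule mult_mono) (auto intro!: real_le_rsqrt srw1_pow_nonneg srw1_pow_sq_le)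
    also have "\<dots> = 4 * real k * (?s * ?s)" by (simp only: mult.assoc)
    also have "\<dots> = 8 * (real k / (real k + 1))" by simp
    also have "\<dots> \<le> 8 * 1" by (intro mult_left_mono) auto
    finally show ?thesis by (simp add: mult_ac)
  qed
  have "(\<bar>a\<bar> \<le> \<bar>a + b\<bar> \<and> \<bar>b\<bar> \<le> \<bar>a + b\<bar>) \<or> (\<bar>a\<bar> \<le> \<bar>a - b\<bar> \<and> \<bar>b\<bar> \<le> \<bar>a - b\<bar>)"
    by arith
  then have "maxnorm z \<le> nat \<bar>a + b\<bar> \<or> maxnorm z \<le> nat \<bar>a - b\<bar>"
    by (simp add: maxnorm_le_iff z)
  then have "maxnorm z \<le> \<bar>a + b\<bar> \<or> maxnorm z \<le> \<bar>a - b\<bar>"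
    by (simp add: le_nat_iff)
  then have "real_of_int (maxnorm z) \<le> real_of_int \<bar>a + b\<bar> \<or> real_of_int (maxnorm z) \<le> real_of_int \<bar>a - b\<bar>"
    by (simp only: of_int_le_iff)
  then show ?thesis
    using *[of "a + b" "a - b"] *[of "a - b" "a + b"] by (auto simp: z srw_pow_eq mult_ac)
qed

lemma srw_pow_even_ge:
  assumes "even k" "0 < k" "even (a + b)" "4 * (maxnorm (a, b))\<^sup>2 \<le> k"
  shows "1 / (8 * (real k + 1)) \<le> srw_pow k (a, b)"
proof -
  have sq: "j\<^sup>2 \<le> int k" if "\<bar>j\<bar> \<le> 2 * int (maxnorm (a, b))" for j
  proof -
    have "j\<^sup>2 \<le> (2 * int (maxnorm (a, b)))\<^sup>2"
      using that by (intro iffD1[OF abs_le_square_iff]) auto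
    also have "\<dots> = int (4 * (maxnorm (a, b))\<^sup>2)" by simp
    also have "\<dots> \<le> int k" using assms by (simp only: of_nat_le_iff)
    finally show ?thesis .
  qed
  have sum_le: "\<bar>a + b\<bar> \<le> 2 * int (maxnorm (a, b))" "\<bar>a - b\<bar> \<le> 2 * int (maxnorm (a, b))"
    using abs_fst_le_maxnorm[of "(a, b)"] abs_snd_le_maxnorm[of "(a, b)"] unfolding fst_conv snd_conv by linarith+
  let ?c = "1 / (4 * (2 * real k + 1))"
  have p: "sqrt ?c \<le> srw1_pow k (a + b)"
    using assms sum_le by (intro real_le_lsqrt srw1_pow_nonneg srw1_pow_sq_ge sq) auto
  have m: "sqrt ?c \<le> srw1_pow k (a - b)"
    using assms sum_le by (intro real_le_lsqrt srw1_pow_nonneg srw1_pow_sq_ge sq) auto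
  have "1 / (8 * (real k + 1)) \<le> ?c" by (simp add: field_simps)
  also have "\<dots> = sqrt ?c * sqrt ?c" by simp
  also have "\<dots> \<le> srw1_pow k (a + b) * srw1_pow k (a - b)"
    using p m srw1_pow_nonneg by (intro mult_mono) auto
  finally show ?thesis by (simp add: srw_pow_eq)
qed

lemma srw_pow_Suc_ge: "srw_pow k (a - 1, b) / 4 \<le> srw_pow (Suc k) (a, b)"
  using srw_pow_nonneg[of k "(a + 1, b)"] srw_pow_nonneg[of k "(a, b + 1)"] srw_pow_nonneg[of k "(a, b - 1)"]
  by simp

text \<open>One of the two times has the parity of a + b. If a + b is odd, the bound comes from the
  neighbour (a - 1, b) one step earlier, which explains the + 1 in the hypothesis and the constant
  32 = 4 * 8.\<close>

lemma srw_pow_consecutive_ge: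
  assumes "4 * (maxnorm z + 1)\<^sup>2 < k"
  shows "1 / (32 * (real k + 2)) \<le> srw_pow k z + srw_pow (Suc k) z"
proof -
  obtain a b where z: "z = (a, b)" by fastforce
  have mn: "maxnorm (a - 1, b) \<le> maxnorm z + 1"
    using abs_fst_le_maxnorm[of z] abs_snd_le_maxnorm[of z] by (auto simp: maxnorm_le_iff z)
  have sq1: "(maxnorm (a - 1, b))\<^sup>2 \<le> (maxnorm z + 1)\<^sup>2" "(maxnorm z)\<^sup>2 \<le> (maxnorm z + 1)\<^sup>2"
    using mn by (auto intro!: power_mono)
  have lb: "4 * (maxnorm (a - 1, b))\<^sup>2 < k" "4 * (maxnorm z)\<^sup>2 < k"
    using assms sq1 by linarith+
  have "1 \<le> (maxnorm z + 1)\<^sup>2" by simp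
  then have k: "4 < k" using assms by linarith
  have le: "1 / (32 * (real k + 2)) \<le> 1 / (8 * (real l + 1)) / 4" if "l \<le> Suc k" for l
    using that by (simp add: field_simps)
  have le': "1 / (8 * (real l + 1)) / 4 \<le> 1 / (8 * (real l + 1))" for l
    by (simp add: field_simps)
  note nn = srw_pow_nonneg[of k z] srw_pow_nonneg[of "Suc k" z]
  show ?thesis
  proof (cases "even (a + b)")
    case True
    have *: "1 / (32 * (real k + 2)) \<le> srw_pow l z" if "even l" "k \<le> l" "l \<le> Suc k" for l
    proof -
      have "1 / (8 * (real l + 1)) \<le> srw_pow l (a, b)"
        using True that lb unfolding z by (intro srw_pow_even_ge) auto
      then show ?thesis using le[of l] le'[of l] that by (simp add: z)
    qed
    show ?thesis
    proof (cases "even k")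
      case True
      then show ?thesis using *[of k] nn by simp
    next
      case False
      then show ?thesis using *[of "Suc k"] nn by (simp del: srw_pow.simps)
    qed
  next
    case False
    have *: "1 / (32 * (real k + 2)) \<le> srw_pow (Suc l) z" if "even l" "k \<le> Suc l" "l \<le> k" for l
    proof -
      have "1 / (32 * (real k + 2)) \<le> 1 / (8 * (real l + 1)) / 4" using le[of l] that by simp
      also have "\<dots> \<le> srw_pow l (a - 1, b) / 4"
        using False that lb k by (intro divide_right_mono srw_pow_even_ge) auto
      also have "\<dots> \<le> srw_pow (Suc l) z" unfolding z by (rule srw_pow_Suc_ge)
      finally show ?thesis .
    qed
    show ?thesis
    proof (cases "even k")
      case True
      then show ?thesis using *[of k] nn by (simp del: srw_pow.simps)
    next
      case odd: False
      then obtain l where "k = Suc l" "even l" by (auto elim: oddE)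
      then show ?thesis using *[of l] nn by (simp del: srw_pow.simps)
    qed
  qed
qed

section \<open>Two-sided bounds for the Green function\<close>

definition green :: "real \<Rightarrow> pt \<Rightarrow> real" where
  "green \<alpha> z = (\<Sum>k. green_coeff (\<alpha> / 2) k * srw_pow k z)"

lemma green_bound_sums:
  assumes "0 < \<alpha>" "\<alpha> < 2"
  shows "(\<lambda>k. 2 * (green_coeff (\<alpha> / 2) (m + k) / (real (m + k + 1)))) sums (2 * (green_coeff (\<alpha> / 2) m / (1 - \<alpha> / 2)))"
  using assms by (intro sums_mult green_coeff_tail_sums) auto

lemma green_term_le:
  assumes "0 < \<alpha>"
  shows "green_coeff (\<alpha> / 2) k * srw_pow k z \<le> 2 * (green_coeff (\<alpha> / 2) k / real (k + 1))"
  using mult_left_mono[OF srw_pow_le, of "green_coeff (\<alpha> / 2) k" k z] green_coeff_pos[of "\<alpha> / 2" k] assms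
  by (simp add: mult_ac add.commute)

lemma green_term_nonneg: "0 < \<alpha> \<Longrightarrow> 0 \<le> green_coeff (\<alpha> / 2) k * srw_pow k z"
  using green_coeff_pos[of "\<alpha> / 2" k] srw_pow_nonneg[of k z] by simp

lemma green_summable:
  assumes "0 < \<alpha>" "\<alpha> < 2"
  shows "summable (\<lambda>k. green_coeff (\<alpha> / 2) k * srw_pow k z)"
proof (rule summable_comparison_test')
  show "summable (\<lambda>k. 2 * (green_coeff (\<alpha> / 2) k / real (k + 1)))"
    using sums_summable[OF green_bound_sums[OF assms, of 0]] by simp
  show "norm (green_coeff (\<alpha> / 2) k * srw_pow k z) \<le> 2 * (green_coeff (\<alpha> / 2) k / real (k + 1))" for k
    using green_term_le[OF assms(1), of k z] green_term_nonneg[OF assms(1), of k z] by simp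
qed

lemma green_nonneg: "0 < \<alpha> \<Longrightarrow> \<alpha> < 2 \<Longrightarrow> 0 \<le> green \<alpha> z"
  unfolding green_def by (intro suminf_nonneg green_summable green_term_nonneg)

lemma green_tail_le:
  assumes "0 < \<alpha>" "\<alpha> < 2"
  shows "(\<Sum>k. green_coeff (\<alpha> / 2) (m + k) * srw_pow (m + k) z) \<le> 2 * (green_coeff (\<alpha> / 2) m / (1 - \<alpha> / 2))"
  unfolding sums_unique[OF green_bound_sums[OF assms, of m]]
proof (rule suminf_le)
  show "summable (\<lambda>k. green_coeff (\<alpha> / 2) (m + k) * srw_pow (m + k) z)"
    using summable_ignore_initial_segment[OF green_summable[OF assms, of z], of m] by (simp add: add.commute)
  show "summable (\<lambda>k. 2 * (green_coeff (\<alpha> / 2) (m + k) / real (m + k + 1)))"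
    by (rule sums_summable[OF green_bound_sums[OF assms]])
qed (rule green_term_le[OF assms(1)])

text \<open>The series is split at the diffusive time m = (maxnorm z)^2. Before m the kernel is at
  most 8/m and the coefficients add up to order m d_m; from m on the uniform bound and the
  telescoped tail give order d_m.\<close>

lemma green_le_green_coeff:
  assumes "0 < \<alpha>" "\<alpha> < 2"
  shows "green \<alpha> z \<le> (32 / \<alpha> + 4 / (2 - \<alpha>)) * green_coeff (\<alpha> / 2) ((maxnorm z)\<^sup>2)"
proof -
  define b where "b = \<alpha> / 2"
  have b: "0 < b" "b < 1" using assms by (auto simp: b_def)
  define n where "n = maxnorm z"
  define m where "m = n\<^sup>2"
  define t where "t k = green_coeff b k * srw_pow k z" for k
  have split: "green \<alpha> z = (\<Sum>k. t (m + k)) + (\<Sum>k<m. t k)"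
    using suminf_split_initial_segment[OF green_summable[OF assms, of z], of m]
    by (simp add: green_def t_def b_def add.commute)
  have tail: "(\<Sum>k. t (m + k)) \<le> 4 / (2 - \<alpha>) * green_coeff b m"
    using green_tail_le[OF assms, of m z] assms by (simp add: t_def b_def field_simps)
  have head: "(\<Sum>k<m. t k) \<le> 32 / \<alpha> * green_coeff b m"
  proof (cases "m = 0")
    case True
    then show ?thesis using assms by simp
  next
    case False
    then have m: "real m > 0" by simp
    have "real m * (\<Sum>k<m. t k) = (\<Sum>k<m. green_coeff b k * (real m * srw_pow k z))"
      by (simp add: sum_distrib_left t_def mult_ac)
    also have "\<dots> \<le> (\<Sum>k<m. green_coeff b k * 8)"
      using srw_pow_le_quadratic[of z] green_coeff_pos[OF b(1)]
      by (intro sum_mono mult_left_mono) (auto simp: m_def n_def intro: less_imp_le)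
    also have "\<dots> \<le> (\<Sum>k\<le>m. green_coeff b k * 8)"
      using green_coeff_pos[OF b(1)] by (intro sum_mono2) (auto intro: less_imp_le)
    also have "\<dots> = 8 * (real m + b) / b * green_coeff b m"
      by (simp add: sum_distrib_right[symmetric] green_coeff_sum[OF b(1)])
    also have "\<dots> \<le> 8 * (real m + real m) / b * green_coeff b m"
      using m b False green_coeff_pos[OF b(1), of m]
      by (intro mult_right_mono divide_right_mono) auto
    also have "\<dots> = real m * (32 / \<alpha> * green_coeff b m)"
      using assms by (simp add: b_def field_simps)
    finally show ?thesis using m by (simp only: mult_le_cancel_left_pos)
  qed
  show ?thesis
    using split tail head by (simp add: b_def m_def n_def algebra_simps)
qed

text \<open>Only times from m on are used, when the walk has had time to spread to z. Pairing the
  times l and l + 1, both with coefficient at least d_(l+1), removes parity. Each term is used at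
  most twice, hence 32 (2 - \<alpha>) = 2 * 32 (1 - \<alpha>/2).\<close>

lemma green_ge_green_coeff:
  assumes "0 < \<alpha>" "\<alpha> < 2" and m: "4 * (maxnorm z + 1)\<^sup>2 < m"
  shows "green_coeff (\<alpha> / 2) (Suc m) / (32 * (2 - \<alpha>)) \<le> green \<alpha> z"
proof -
  define b where "b = \<alpha> / 2"
  have b: "0 < b" "b < 1" using assms by (auto simp: b_def)
  define t where "t k = green_coeff b k * srw_pow k z" for k
  have t: "summable t" "\<And>k. 0 \<le> t k" "green \<alpha> z = suminf t"
    using green_summable[OF assms(1,2), of z] green_term_nonneg[OF assms(1)]
    by (simp_all add: t_def[abs_def] b_def green_def)
  have s: "summable (\<lambda>k. t (m + k))" "summable (\<lambda>k. t (Suc m + k))"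
    using summable_ignore_initial_segment[OF t(1), of m] summable_ignore_initial_segment[OF t(1), of "Suc m"]
    by (simp_all add: add.commute)
  have tail: "(\<Sum>k. t (l + k)) \<le> suminf t" for l
    using suminf_split_initial_segment[OF t(1), of l] sum_nonneg[of "{..<l}" t] t(2)
    by (simp add: add.commute)
  have "green_coeff b (Suc m) / (1 - b) / 32 = (\<Sum>k. green_coeff b (Suc m + k) / real (Suc m + k + 1) / 32)"
    by (rule sums_unique[OF sums_divide[OF green_coeff_tail_sums[OF b]]])
  also have "\<dots> \<le> (\<Sum>k. t (m + k) + t (Suc m + k))"
  proof (rule suminf_le)
    fix k
    have d: "green_coeff b (Suc (m + k)) \<le> green_coeff b (m + k)"
      using b by (intro green_coeff_antimono) auto
    have "green_coeff b (Suc (m + k)) * (1 / (32 * (real (m + k) + 2))) \<le>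
        green_coeff b (Suc (m + k)) * (srw_pow (m + k) z + srw_pow (Suc (m + k)) z)"
      using m green_coeff_pos[OF b(1)] by (intro mult_left_mono srw_pow_consecutive_ge) (auto intro: less_imp_le)
    also have "\<dots> \<le> t (m + k) + t (Suc m + k)"
      using mult_right_mono[OF d srw_pow_nonneg[of "m + k" z]] by (simp add: t_def distrib_left del: srw_pow.simps)
    finally show "green_coeff b (Suc m + k) / real (Suc m + k + 1) / 32 \<le> t (m + k) + t (Suc m + k)"
      by (simp add: field_simps)
    show "summable (\<lambda>k. green_coeff b (Suc m + k) / real (Suc m + k + 1) / 32)"
      by (rule sums_summable[OF sums_divide[OF green_coeff_tail_sums[OF b]]])
  qed (rule summable_add[OF s])
  also have "\<dots> = (\<Sum>k. t (m + k)) + (\<Sum>k. t (Suc m + k))"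
    using s by (rule suminf_add[symmetric])
  also have "\<dots> \<le> 2 * green \<alpha> z"
    using tail[of m] tail[of "Suc m"] t(3) by simp
  finally show ?thesis using assms by (simp add: b_def field_simps)
qed

section \<open>Max-norm and the Riesz kernel\<close>

lemma maxnorm_0 [simp]: "maxnorm 0 = 0"
  by (simp add: maxnorm_def)

lemma maxnorm_eq_0_iff [simp]: "maxnorm z = 0 \<longleftrightarrow> z = 0"
  by (cases z) (auto simp: maxnorm_def zero_prod_def)

lemma maxnorm_pos_iff [simp]: "0 < maxnorm z \<longleftrightarrow> z \<noteq> 0"
  by (metis maxnorm_eq_0_iff neq0_conv)

lemma maxnorm_diff_le: "maxnorm (x - y) \<le> maxnorm x + maxnorm y"
  using abs_fst_le_maxnorm[of x] abs_fst_le_maxnorm[of y] abs_snd_le_maxnorm[of x] abs_snd_le_maxnorm[of y]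
  unfolding maxnorm_le_iff fst_diff snd_diff of_nat_add by linarith

lemma maxnorm_diff_ge: "maxnorm x - maxnorm y \<le> maxnorm (x - y)"
proof -
  have "maxnorm x \<le> maxnorm (x - y) + maxnorm y"
    using abs_fst_le_maxnorm[of "x - y"] abs_fst_le_maxnorm[of y] abs_snd_le_maxnorm[of "x - y"] abs_snd_le_maxnorm[of y]
    unfolding maxnorm_le_iff fst_diff snd_diff of_nat_add by linarith
  then show ?thesis by simp
qed

lemma maxnorm_commute: "maxnorm (x - y) = maxnorm (y - x)"
  unfolding maxnorm_def fst_diff snd_diff by (simp add: abs_minus_commute)

text \<open>The truncation matters at the origin, where \<open>0 powr (\<alpha> - 2)\<close> is 0:
  with it the kernel is positive everywhere and, for \<alpha> < 2, antitone from 0 on.\<close>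

definition riesz :: "real \<Rightarrow> nat \<Rightarrow> real" where
  "riesz \<alpha> r = real (max 1 r) powr (\<alpha> - 2)"

lemma riesz_pos: "0 < riesz \<alpha> r"
  by (simp add: riesz_def)

lemma riesz_antimono: "\<alpha> < 2 \<Longrightarrow> r \<le> s \<Longrightarrow> riesz \<alpha> s \<le> riesz \<alpha> r"
  unfolding riesz_def by (intro powr_mono2') auto

lemma riesz_le_1: "\<alpha> < 2 \<Longrightarrow> riesz \<alpha> r \<le> 1"
  using riesz_antimono[of \<alpha> 0 r] by (simp add: riesz_def)

lemma powr_square: "0 \<le> x \<Longrightarrow> (x\<^sup>2) powr (\<alpha> / 2 - 1) = x powr (\<alpha> - 2)" for x :: real
  using powr_powr[of x 2 "\<alpha> / 2 - 1"] by (simp add: right_diff_distrib)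

lemma green_upper:
  assumes "0 < \<alpha>" "\<alpha> < 2"
  obtains C where "0 < C" "\<And>z. green \<alpha> z \<le> C * riesz \<alpha> (maxnorm z)"
proof
  let ?C = "32 / \<alpha> + 4 / (2 - \<alpha>)"
  show C: "0 < ?C" using assms by (simp add: add_pos_pos)
  fix z
  have "green_coeff (\<alpha> / 2) ((maxnorm z)\<^sup>2) \<le> riesz \<alpha> (maxnorm z)"
  proof (cases "maxnorm z = 0")
    case True
    then show ?thesis by (simp add: riesz_def)
  next
    case False
    then have "1 \<le> maxnorm z" by linarith
    then have "max 1 (maxnorm z) = maxnorm z" "1 \<le> (maxnorm z)\<^sup>2" by auto
    then show ?thesis
      using green_coeff_le[of "\<alpha> / 2" "(maxnorm z)\<^sup>2"] powr_square[of "real (maxnorm z)" \<alpha>] assms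
      by (simp add: riesz_def)
  qed
  then show "green \<alpha> z \<le> ?C * riesz \<alpha> (maxnorm z)"
    using green_le_green_coeff[OF assms, of z] C by (smt (verit) mult_left_mono)
qed

text \<open>The radius only has to dominate half the norm of z, because the bound is applied to z =
  x - b with r the norm of b and x no farther from the origin than b.\<close>

lemma green_lower:
  assumes "0 < \<alpha>" "\<alpha> < 2"
  obtains c where "0 < c" "\<And>z r. 1 \<le> r \<Longrightarrow> maxnorm z \<le> 2 * r \<Longrightarrow> c * riesz \<alpha> r \<le> green \<alpha> z"
proof
  \<comment> \<open>The 38 comes from maxnorm z + 1 \<le> 3r: then 4 (maxnorm z + 1)^2 \<le> 36 r^2
    < 38 r^2 - 1, an admissible starting time for the lower bound.\<close>
  let ?c = "\<alpha> / 2 * 38 powr (\<alpha> / 2 - 1) / (32 * (2 - \<alpha>))"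
  show "0 < ?c" using assms by simp
  fix z and r :: nat
  assume r: "1 \<le> r" "maxnorm z \<le> 2 * r"
  have "(maxnorm z + 1)\<^sup>2 \<le> (3 * r)\<^sup>2" using r by (intro power_mono) auto
  then have "4 * (maxnorm z + 1)\<^sup>2 \<le> 36 * r\<^sup>2" by (simp add: power_mult_distrib)
  moreover have "1 \<le> r\<^sup>2" using r by simp
  ultimately have M: "4 * (maxnorm z + 1)\<^sup>2 < 38 * r\<^sup>2 - 1" "Suc (38 * r\<^sup>2 - 1) = 38 * r\<^sup>2" by linarith+
  have "\<alpha> / 2 * (38 * (real r)\<^sup>2) powr (\<alpha> / 2 - 1) \<le> green_coeff (\<alpha> / 2) (38 * r\<^sup>2)"
    using green_coeff_ge[of "\<alpha> / 2" "38 * r\<^sup>2"] assms \<open>1 \<le> r\<^sup>2\<close> by simp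
  then have "\<alpha> / 2 * (38 powr (\<alpha> / 2 - 1) * riesz \<alpha> r) \<le> green_coeff (\<alpha> / 2) (38 * r\<^sup>2)"
    using r by (simp add: powr_mult powr_square riesz_def max_def)
  then have "\<alpha> / 2 * (38 powr (\<alpha> / 2 - 1) * riesz \<alpha> r) / (32 * (2 - \<alpha>)) \<le> green_coeff (\<alpha> / 2) (38 * r\<^sup>2) / (32 * (2 - \<alpha>))"
    using assms by (intro divide_right_mono) auto
  also have "\<dots> \<le> green \<alpha> z"
    using green_ge_green_coeff[OF assms M(1)] M(2) by simp
  finally show "?c * riesz \<alpha> r \<le> green \<alpha> z" by (simp add: mult_ac)
qed

section \<open>The renewal equation\<close>

text \<open>The operator P on functions. Values in \<open>ennreal\<close> allow sums and integrals
  to be exchanged without summability conditions.\<close>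

definition nbr_avg :: "(pt \<Rightarrow> ennreal) \<Rightarrow> pt \<Rightarrow> ennreal" where
  "nbr_avg f x = ennreal (1 / 4) * (f (x + (1, 0)) + f (x + (-1, 0)) + f (x + (0, 1)) + f (x + (0, -1)))"

lemma nn_integral_count_space_translate:
  fixes f :: "pt \<Rightarrow> ennreal"
  shows "(\<integral>\<^sup>+z. f (z + a) \<partial>count_space UNIV) = (\<integral>\<^sup>+z. f z \<partial>count_space UNIV)"
  by (rule nn_integral_bij_count_space) (auto intro!: bij_betwI[of _ _ _ "\<lambda>z. z - a"])

lemma ennreal_srw_pow_Suc:
  "ennreal (srw_pow (Suc k) z) = nbr_avg (\<lambda>z. ennreal (srw_pow k z)) z"
proof -
  obtain a b where z: "z = (a, b)" by fastforce
  have "srw_pow (Suc k) z =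
      1 / 4 * (srw_pow k (z + (1, 0)) + srw_pow k (z + (-1, 0)) + srw_pow k (z + (0, 1)) + srw_pow k (z + (0, -1)))"
    by (simp add: z add_ac)
  then have "ennreal (srw_pow (Suc k) z) = ennreal (1 / 4) *
      ennreal (srw_pow k (z + (1, 0)) + srw_pow k (z + (-1, 0)) + srw_pow k (z + (0, 1)) + srw_pow k (z + (0, -1)))"
    by (simp only: ennreal_mult srw_pow_nonneg add_nonneg_nonneg divide_nonneg_nonneg zero_le_one zero_le_numeral)
  then show ?thesis
    by (simp only: nbr_avg_def ennreal_plus srw_pow_nonneg add_nonneg_nonneg)
qed

lemma nn_integral_srw_pow:
  "(\<integral>\<^sup>+z. ennreal (srw_pow k z) * f (x + z) \<partial>count_space UNIV) = (nbr_avg ^^ k) f x"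
proof (induction k arbitrary: x)
  case 0
  have "(\<integral>\<^sup>+z. ennreal (srw_pow 0 z) * f (x + z) \<partial>count_space UNIV) =
      (\<integral>\<^sup>+z. f x * indicator {0 :: pt} z \<partial>count_space UNIV)"
    by (intro nn_integral_cong) (auto split: split_indicator simp: zero_prod_def[symmetric])
  then show ?case by (simp add: nn_integral_cmult)
next
  case (Suc k)
  \<comment> \<open>Moving a shift from the kernel to f reverses its sign; the four steps are closed
    under negation, so the same average reappears.\<close>
  have shift: "(\<integral>\<^sup>+z. ennreal (srw_pow k (z + e)) * f (x + z) \<partial>count_space UNIV) = (nbr_avg ^^ k) f (x + - e)" for e
    using nn_integral_count_space_translate[of "\<lambda>z. ennreal (srw_pow k z) * f (x - e + z)" e] Suc[of "x - e"]
    by (simp add: algebra_simps)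
  have "(\<integral>\<^sup>+z. ennreal (srw_pow (Suc k) z) * f (x + z) \<partial>count_space UNIV) =
      (\<integral>\<^sup>+z. ennreal (1 / 4) * (ennreal (srw_pow k (z + (1, 0))) * f (x + z) + ennreal (srw_pow k (z + (-1, 0))) * f (x + z)
        + ennreal (srw_pow k (z + (0, 1))) * f (x + z) + ennreal (srw_pow k (z + (0, -1))) * f (x + z)) \<partial>count_space UNIV)"
    unfolding ennreal_srw_pow_Suc by (intro nn_integral_cong) (simp add: nbr_avg_def distrib_right mult.assoc)
  also have "\<dots> = nbr_avg ((nbr_avg ^^ k) f) x"
    unfolding nbr_avg_def[of "(nbr_avg ^^ k) f"] by (simp add: nn_integral_cmult nn_integral_add shift) (simp add: add_ac)
  finally show ?case by simp
qed

lemma nbr_avg_srw_pow: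
  "(nbr_avg ^^ j) (\<lambda>z. ennreal (srw_pow k z)) = (\<lambda>z. ennreal (srw_pow (j + k) z))"
proof (induction j)
  case (Suc j)
  then show ?case by (simp add: ennreal_srw_pow_Suc[symmetric] del: srw_pow.simps)
qed simp

lemma nbr_avg_1: "(nbr_avg ^^ j) (\<lambda>_. 1) = (\<lambda>_. 1)"
proof (induction j)
  case (Suc j)
  have "ennreal (1 / 4) * (1 + 1 + 1 + 1) = ennreal (1 / 4) * ennreal 4"
    by simp
  also have "\<dots> = 1"
    by (subst ennreal_mult[symmetric]) auto
  finally have "nbr_avg (\<lambda>_. 1) = (\<lambda>_. 1)"
    by (simp only: nbr_avg_def fun_eq_iff simp_thms)
  then show ?case by (simp add: Suc)
qed simp

text \<open>Tonelli for the substitution m = n + k, with the constraint n \<le> m carried by an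
  indicator.\<close>

lemma suminf_triangle:
  fixes \<phi> :: "nat \<Rightarrow> nat \<Rightarrow> ennreal"
  shows "(\<Sum>n. \<Sum>k. \<phi> n k) = (\<Sum>m. \<Sum>n\<le>m. \<phi> n (m - n))"
proof -
  let ?\<psi> = "\<lambda>(n, m). \<phi> n (m - n) * indicator {n..} m"
  have "(\<Sum>n. \<Sum>k. \<phi> n k) = (\<integral>\<^sup>+p. (case p of (n, k) \<Rightarrow> \<phi> n k) \<partial>count_space UNIV)"
    by (simp add: nn_integral_fst_count_space[symmetric] nn_integral_count_space_nat)
  also have "\<dots> = (\<integral>\<^sup>+p. ?\<psi> ((\<lambda>(n, k). (n, n + k)) p) \<partial>count_space UNIV)"
    by (intro nn_integral_cong) auto
  also have "\<dots> = (\<integral>\<^sup>+p. ?\<psi> p \<partial>count_space {(n, m). n \<le> m})"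
    by (rule nn_integral_bij_count_space) (auto intro!: bij_betwI[of _ _ _ "\<lambda>(n, m). (n, m - n)"])
  also have "\<dots> = (\<integral>\<^sup>+p. ?\<psi> p \<partial>count_space UNIV)"
    by (subst nn_integral_count_space_indicator) (auto intro!: nn_integral_cong split: split_indicator)
  also have "\<dots> = (\<Sum>m. \<Sum>n. ?\<psi> (n, m))"
    by (simp add: nn_integral_snd_count_space[symmetric] nn_integral_count_space_nat)
  also have "\<dots> = (\<Sum>m. \<Sum>n\<le>m. \<phi> n (m - n))"
  proof (intro arg_cong[where f = suminf] ext)
    fix m
    have "(\<Sum>n. ?\<psi> (n, m)) = (\<Sum>n\<le>m. ?\<psi> (n, m))"
      by (rule suminf_finite) auto
    then show "(\<Sum>n. ?\<psi> (n, m)) = (\<Sum>n\<le>m. \<phi> n (m - n))" by simp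
  qed
  finally show ?thesis .
qed

section \<open>The step distribution and its Green function\<close>

context
  fixes \<alpha> :: real
  assumes \<alpha>: "0 < \<alpha>" "\<alpha> < 2"
begin

lemma stable_kernel_summable: "summable (\<lambda>k. stable_coeff \<alpha> (Suc k) * srw_pow (Suc k) z)"
proof (rule summable_comparison_test')
  show "summable (\<lambda>k. stable_coeff \<alpha> (Suc k) * 2)"
    using stable_coeff_sums[OF \<alpha>] by (intro summable_mult2) (auto simp: sums_iff)
  fix k
  have "srw_pow (Suc k) z \<le> 2 / (real (Suc k) + 1)" by (rule srw_pow_le)
  also have "\<dots> \<le> 2" by (simp add: field_simps)
  finally show "norm (stable_coeff \<alpha> (Suc k) * srw_pow (Suc k) z) \<le> stable_coeff \<alpha> (Suc k) * 2"
    using stable_coeff_Suc_pos[OF \<alpha>, of k] srw_pow_nonneg[of "Suc k" z] by (simp del: srw_pow.simps)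
qed

lemma stable_kernel_term_nonneg: "0 \<le> stable_coeff \<alpha> (Suc k) * srw_pow (Suc k) z"
  using stable_coeff_Suc_pos[OF \<alpha>, of k] srw_pow_nonneg[of "Suc k" z] by (simp del: srw_pow.simps)

lemma stable_kernel_nonneg: "0 \<le> stable_kernel \<alpha> z"
  unfolding stable_kernel_def by (intro suminf_nonneg stable_kernel_summable stable_kernel_term_nonneg)

lemma ennreal_stable_kernel:
  "ennreal (stable_kernel \<alpha> z) = (\<Sum>k. ennreal (stable_coeff \<alpha> (Suc k)) * ennreal (srw_pow (Suc k) z))"
  unfolding stable_kernel_def using stable_coeff_Suc_pos[OF \<alpha>] srw_pow_nonneg
  by (subst suminf_ennreal2[symmetric, OF stable_kernel_term_nonneg stable_kernel_summable])
    (simp add: ennreal_mult less_imp_le del: srw_pow.simps)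

lemma nn_integral_stable_kernel:
  "(\<integral>\<^sup>+z. ennreal (stable_kernel \<alpha> z) * f (x + z) \<partial>count_space UNIV) =
    (\<Sum>k. ennreal (stable_coeff \<alpha> (Suc k)) * (nbr_avg ^^ Suc k) f x)"
proof -
  have "(\<integral>\<^sup>+z. ennreal (stable_kernel \<alpha> z) * f (x + z) \<partial>count_space UNIV) =
      (\<integral>\<^sup>+z. (\<Sum>k. ennreal (stable_coeff \<alpha> (Suc k)) * (ennreal (srw_pow (Suc k) z) * f (x + z))) \<partial>count_space UNIV)"
    unfolding ennreal_stable_kernel by (intro nn_integral_cong) (simp add: mult.assoc[symmetric] del: srw_pow.simps)
  also have "\<dots> = (\<Sum>k. \<integral>\<^sup>+z. ennreal (stable_coeff \<alpha> (Suc k)) * (ennreal (srw_pow (Suc k) z) * f (x + z)) \<partial>count_space UNIV)"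
    by (rule nn_integral_suminf) simp
  also have "\<dots> = (\<Sum>k. ennreal (stable_coeff \<alpha> (Suc k)) * (nbr_avg ^^ Suc k) f x)"
    by (simp only: nn_integral_cmult nn_integral_srw_pow measurable_count_space_eq1 space_borel Pi_UNIV UNIV_I)
  finally show ?thesis .
qed

text \<open>With nonnegativity this justifies \<open>embed_pmf\<close> in
  \<open>stable_step\<close>. The constant 1 is fixed by P, so only the sum of the step coefficients
  remains.\<close>

lemma stable_kernel_total: "(\<integral>\<^sup>+z. ennreal (stable_kernel \<alpha> z) \<partial>count_space UNIV) = 1"
proof -
  have "(\<integral>\<^sup>+z. ennreal (stable_kernel \<alpha> z) \<partial>count_space UNIV) = (\<Sum>k. ennreal (stable_coeff \<alpha> (Suc k)))"
    using nn_integral_stable_kernel[of "\<lambda>_. 1" 0] by (simp only: nbr_avg_1 mult_1_right)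
  also have "\<dots> = ennreal 1"
    using stable_coeff_sums[OF \<alpha>] stable_coeff_Suc_pos[OF \<alpha>]
    by (subst suminf_ennreal2) (auto simp: sums_iff less_imp_le)
  finally show ?thesis by simp
qed

lemma pmf_stable_step: "pmf (stable_step \<alpha>) z = stable_kernel \<alpha> z"
  unfolding stable_step_def by (rule pmf_embed_pmf[OF stable_kernel_nonneg stable_kernel_total])

lemma nn_integral_stable_step:
  "(\<integral>\<^sup>+z. f (x + z) \<partial>measure_pmf (stable_step \<alpha>)) =
    (\<Sum>k. ennreal (stable_coeff \<alpha> (Suc k)) * (nbr_avg ^^ Suc k) f x)"
  by (simp only: nn_integral_measure_pmf pmf_stable_step nn_integral_stable_kernel)

text \<open>The form of irreducibility used in the maximum principle: a maximum is passed on to the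
  right neighbour.\<close>

lemma pmf_stable_step_right_pos: "0 < pmf (stable_step \<alpha>) (1, 0)"
proof -
  have "0 < stable_coeff \<alpha> (Suc 0) * srw_pow (Suc 0) (1, 0)"
    using stable_coeff_Suc_pos[OF \<alpha>, of 0] by simp
  also have "\<dots> \<le> (\<Sum>k. stable_coeff \<alpha> (Suc k) * srw_pow (Suc k) (1, 0))"
    using sum_le_suminf[OF stable_kernel_summable, of "{0}" "(1, 0)"] stable_kernel_term_nonneg by (simp del: srw_pow.simps)
  finally show ?thesis by (simp add: pmf_stable_step stable_kernel_def)
qed

lemma ennreal_green: "ennreal (green \<alpha> z) = (\<Sum>k. ennreal (green_coeff (\<alpha> / 2) k) * ennreal (srw_pow k z))"
  unfolding green_def using green_coeff_pos[of "\<alpha> / 2"] \<alpha> srw_pow_nonneg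
  by (subst suminf_ennreal2[symmetric, OF green_term_nonneg green_summable]) (simp_all add: ennreal_mult less_imp_le)

lemma nbr_avg_green:
  "(nbr_avg ^^ j) (\<lambda>z. ennreal (green \<alpha> z)) x =
    (\<Sum>k. ennreal (green_coeff (\<alpha> / 2) k) * ennreal (srw_pow (j + k) x))"
proof -
  have "(nbr_avg ^^ j) (\<lambda>z. ennreal (green \<alpha> z)) x =
      (\<integral>\<^sup>+z. (\<Sum>k. ennreal (green_coeff (\<alpha> / 2) k) * (ennreal (srw_pow j z) * ennreal (srw_pow k (x + z)))) \<partial>count_space UNIV)"
    unfolding nn_integral_srw_pow[symmetric] ennreal_green ennreal_suminf_cmult[symmetric]
    by (simp only: mult.left_commute)
  also have "\<dots> = (\<Sum>k. \<integral>\<^sup>+z. ennreal (green_coeff (\<alpha> / 2) k) * (ennreal (srw_pow j z) * ennreal (srw_pow k (x + z))) \<partial>count_space UNIV)"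
    by (rule nn_integral_suminf) simp
  also have "\<dots> = (\<Sum>k. ennreal (green_coeff (\<alpha> / 2) k) * ennreal (srw_pow (j + k) x))"
    by (simp only: nn_integral_cmult measurable_count_space_eq1 space_borel Pi_UNIV UNIV_I
        nn_integral_srw_pow[of j "\<lambda>z. ennreal (srw_pow _ z)"] nbr_avg_srw_pow)
  finally show ?thesis .
qed

text \<open>Applying P_\<alpha> to the Green series and collecting powers of P, the convolution
  identity returns the same series without its term k = 0, and that term is the unit mass at the
  origin.\<close>

lemma green_renewal:
  "ennreal (green \<alpha> x) = indicator {0} x + (\<integral>\<^sup>+z. ennreal (green \<alpha> (x + z)) \<partial>measure_pmf (stable_step \<alpha>))"
proof -
  let ?c = "\<lambda>n. ennreal (stable_coeff \<alpha> (Suc n))" and ?d = "\<lambda>k. ennreal (green_coeff (\<alpha> / 2) k)"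
  have "(\<integral>\<^sup>+z. ennreal (green \<alpha> (x + z)) \<partial>measure_pmf (stable_step \<alpha>)) =
      (\<Sum>n. \<Sum>k. ?c n * (?d k * ennreal (srw_pow (Suc (n + k)) x)))"
    using nn_integral_stable_step[of "\<lambda>z. ennreal (green \<alpha> z)" x]
    by (simp only: nbr_avg_green ennreal_suminf_cmult add_Suc)
  also have "\<dots> = (\<Sum>m. \<Sum>n\<le>m. ?c n * (?d (m - n) * ennreal (srw_pow (Suc (n + (m - n))) x)))"
    by (rule suminf_triangle)
  also have "\<dots> = (\<Sum>m. ?d (Suc m) * ennreal (srw_pow (Suc m) x))"
  proof (intro arg_cong[where f = suminf] ext)
    fix m
    have "(\<Sum>n\<le>m. ?c n * (?d (m - n) * ennreal (srw_pow (Suc (n + (m - n))) x))) =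
        (\<Sum>n\<le>m. ennreal (stable_coeff \<alpha> (Suc n) * green_coeff (\<alpha> / 2) (m - n))) * ennreal (srw_pow (Suc m) x)"
      unfolding sum_distrib_right using stable_coeff_Suc_pos[OF \<alpha>] green_coeff_pos[of "\<alpha> / 2"] \<alpha>
      by (intro sum.cong) (simp_all add: ennreal_mult less_imp_le mult.assoc del: srw_pow.simps)
    also have "(\<Sum>n\<le>m. ennreal (stable_coeff \<alpha> (Suc n) * green_coeff (\<alpha> / 2) (m - n))) = ?d (Suc m)"
      using stable_coeff_Suc_pos[OF \<alpha>] green_coeff_pos[of "\<alpha> / 2"] \<alpha>
      by (subst sum_ennreal) (simp_all add: green_coeff_convolution less_imp_le)
    finally show "(\<Sum>n\<le>m. ?c n * (?d (m - n) * ennreal (srw_pow (Suc (n + (m - n))) x))) =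
        ?d (Suc m) * ennreal (srw_pow (Suc m) x)" .
  qed
  finally have T: "(\<integral>\<^sup>+z. ennreal (green \<alpha> (x + z)) \<partial>measure_pmf (stable_step \<alpha>)) =
      (\<Sum>m. ?d (Suc m) * ennreal (srw_pow (Suc m) x))" .
  have "ennreal (green \<alpha> x) = (\<Sum>k. ?d k * ennreal (srw_pow k x))" by (rule ennreal_green)
  also have "\<dots> = (\<Sum>m. ?d (Suc m) * ennreal (srw_pow (Suc m) x)) + (\<Sum>k<Suc 0. ?d k * ennreal (srw_pow k x))"
    using suminf_offset[of "\<lambda>k. ?d k * ennreal (srw_pow k x)" "Suc 0"] by (simp add: add.commute del: srw_pow.simps)
  also have "(\<Sum>k<Suc 0. ?d k * ennreal (srw_pow k x)) = indicator {0} x"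
    by (auto simp: zero_prod_def split: split_indicator)
  finally show ?thesis unfolding T by (simp only: add.commute)
qed

end

section \<open>Hitting probabilities\<close>

text \<open>The bounded horizon makes induction on n possible. Time 0 counts, so points of A are hit
  at once.\<close>

definition hit_by :: "pt pmf \<Rightarrow> pt set \<Rightarrow> nat \<Rightarrow> pt \<Rightarrow> ennreal" where
  "hit_by p A n x = emeasure (stream_space (measure_pmf p)) {\<omega>. \<exists>i\<le>n. walk_pos x \<omega> i \<in> A}"

definition hit :: "pt pmf \<Rightarrow> pt set \<Rightarrow> pt \<Rightarrow> ennreal" where
  "hit p A x = emeasure (stream_space (measure_pmf p)) {\<omega>. \<exists>i. walk_pos x \<omega> i \<in> A}"

lemma walk_pos_0 [simp]: "walk_pos x \<omega> 0 = x"
  by (simp add: walk_pos_def)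

lemma walk_pos_Suc: "walk_pos x \<omega> (Suc n) = walk_pos x \<omega> n + \<omega> !! n"
  by (cases "\<omega> !! n") (simp add: walk_pos_def)

lemma walk_pos_SCons: "walk_pos x (z ## \<omega>) (Suc n) = walk_pos (x + z) \<omega> n"
  by (cases z; cases x) (simp add: walk_pos_def sum.lessThan_Suc_shift del: sum.lessThan_Suc)

lemma space_steps [simp]: "space (stream_space (measure_pmf p)) = UNIV"
  by (simp add: space_stream_space)

lemma walk_pos_measurable [measurable]:
  "(\<lambda>\<omega>. walk_pos x \<omega> n) \<in> stream_space (measure_pmf p) \<rightarrow>\<^sub>M count_space UNIV"
proof (induction n)
  case (Suc n)
  have [measurable]: "(\<lambda>\<omega>. \<omega> !! n) \<in> stream_space (measure_pmf p) \<rightarrow>\<^sub>M count_space UNIV"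
    using measurable_snth[of n "measure_pmf p"] by simp
  note Suc[measurable]
  have "(\<lambda>\<omega>. (walk_pos x \<omega> n, \<omega> !! n)) \<in> stream_space (measure_pmf p) \<rightarrow>\<^sub>M count_space UNIV \<Otimes>\<^sub>M count_space UNIV"
    by measurable
  then have "(\<lambda>\<omega>. (walk_pos x \<omega> n, \<omega> !! n)) \<in> stream_space (measure_pmf p) \<rightarrow>\<^sub>M count_space UNIV"
    by (simp add: pair_measure_countable)
  then have "(\<lambda>\<omega>. (\<lambda>(a, b). a + b) (walk_pos x \<omega> n, \<omega> !! n)) \<in> stream_space (measure_pmf p) \<rightarrow>\<^sub>M count_space UNIV"
    by (rule measurable_compose) simp
  then show ?case by (simp add: walk_pos_Suc)
qed simp

lemma hit_by_sets:
  "{\<omega>. \<exists>i\<le>n. walk_pos x \<omega> i \<in> A} \<in> sets (stream_space (measure_pmf p))"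
proof -
  have "{\<omega>\<in>space (stream_space (measure_pmf p)). \<exists>i\<le>n. walk_pos x \<omega> i \<in> A} \<in> sets (stream_space (measure_pmf p))"
    by measurable
  then show ?thesis by simp
qed

lemma hit_sets:
  "{\<omega>. \<exists>i. walk_pos x \<omega> i \<in> A} \<in> sets (stream_space (measure_pmf p))"
proof -
  have "{\<omega>\<in>space (stream_space (measure_pmf p)). \<exists>i. walk_pos x \<omega> i \<in> A} \<in> sets (stream_space (measure_pmf p))"
    by measurable
  then show ?thesis by simp
qed

lemma prob_space_steps: "prob_space (stream_space (measure_pmf p))"
  by (intro prob_space.prob_space_stream_space measure_pmf.prob_space_axioms)

lemma emeasure_steps_UNIV: "emeasure (stream_space (measure_pmf p)) UNIV = 1"
  using prob_space.emeasure_space_1[OF prob_space_steps[of p]] by simp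

lemma hit_by_in: "x \<in> A \<Longrightarrow> hit_by p A n x = 1"
proof -
  assume "x \<in> A"
  then have "{\<omega>. \<exists>i\<le>n. walk_pos x \<omega> i \<in> A} = UNIV" by (auto intro!: exI[of _ 0])
  then show ?thesis by (simp add: hit_by_def emeasure_steps_UNIV)
qed

lemma hit_by_0: "x \<notin> A \<Longrightarrow> hit_by p A 0 x = 0"
  by (simp add: hit_by_def)

lemma hit_in: "x \<in> A \<Longrightarrow> hit p A x = 1"
proof -
  assume "x \<in> A"
  then have "{\<omega>. \<exists>i. walk_pos x \<omega> i \<in> A} = UNIV" by (auto intro!: exI[of _ 0])
  then show ?thesis by (simp add: hit_def emeasure_steps_UNIV)
qed

text \<open>Markov property at time 1: the stream splits into its head and an independent tail, and
  time 0 contributes nothing off A.\<close>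

lemma hit_by_Suc:
  assumes "x \<notin> A"
  shows "hit_by p A (Suc n) x = (\<integral>\<^sup>+z. hit_by p A n (x + z) \<partial>measure_pmf p)"
proof -
  have "(\<exists>i\<le>Suc n. walk_pos x (z ## \<omega>) i \<in> A) \<longleftrightarrow> (\<exists>i\<le>n. walk_pos (x + z) \<omega> i \<in> A)" for z \<omega>
  proof
    assume "\<exists>i\<le>Suc n. walk_pos x (z ## \<omega>) i \<in> A"
    then obtain i where "i \<le> Suc n" "walk_pos x (z ## \<omega>) i \<in> A" by blast
    then show "\<exists>i\<le>n. walk_pos (x + z) \<omega> i \<in> A"
      using assms by (cases i) (auto simp: walk_pos_SCons)
  next
    assume "\<exists>i\<le>n. walk_pos (x + z) \<omega> i \<in> A"
    then show "\<exists>i\<le>Suc n. walk_pos x (z ## \<omega>) i \<in> A"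
      by (metis walk_pos_SCons Suc_le_mono)
  qed
  then show ?thesis
    unfolding hit_by_def
    by (subst prob_space.emeasure_stream_space[OF measure_pmf.prob_space_axioms hit_by_sets]) simp
qed

lemma hit_not_in:
  assumes "x \<notin> A"
  shows "hit p A x = (\<integral>\<^sup>+z. hit p A (x + z) \<partial>measure_pmf p)"
proof -
  have "(\<exists>i. walk_pos x (z ## \<omega>) i \<in> A) \<longleftrightarrow> (\<exists>i. walk_pos (x + z) \<omega> i \<in> A)" for z \<omega>
  proof
    assume "\<exists>i. walk_pos x (z ## \<omega>) i \<in> A"
    then obtain i where "walk_pos x (z ## \<omega>) i \<in> A" by blast
    then show "\<exists>i. walk_pos (x + z) \<omega> i \<in> A"
      using assms by (cases i) (auto simp: walk_pos_SCons)
  next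
    assume "\<exists>i. walk_pos (x + z) \<omega> i \<in> A"
    then show "\<exists>i. walk_pos x (z ## \<omega>) i \<in> A"
      by (metis walk_pos_SCons)
  qed
  then show ?thesis
    unfolding hit_def
    by (subst prob_space.emeasure_stream_space[OF measure_pmf.prob_space_axioms hit_sets]) simp
qed

lemma hit_by_tendsto: "(\<lambda>n. hit_by p A n x) \<longlonglongrightarrow> hit p A x"
proof -
  let ?M = "stream_space (measure_pmf p)"
  let ?E = "\<lambda>n. {\<omega>. \<exists>i\<le>n. walk_pos x \<omega> i \<in> A}"
  have "(\<lambda>n. emeasure ?M (?E n)) \<longlonglongrightarrow> emeasure ?M (\<Union>n. ?E n)"
    by (intro Lim_emeasure_incseq) (auto simp: incseq_def hit_by_sets intro: order_trans)
  also have "(\<Union>n. ?E n) = {\<omega>. \<exists>i. walk_pos x \<omega> i \<in> A}" by auto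
  finally show ?thesis by (simp add: hit_def hit_by_def)
qed

lemma hit_mono: "A \<subseteq> B \<Longrightarrow> hit p A x \<le> hit p B x"
  unfolding hit_def by (intro emeasure_mono hit_sets) auto

lemma hit_le_1: "hit p A x \<le> 1"
  unfolding hit_def by (rule prob_space.emeasure_le_1[OF prob_space_steps])

lemma stable_massive_iff_hit: "stable_massive \<alpha> A \<longleftrightarrow> (\<forall>x. hit (stable_step \<alpha>) A x = 1)"
proof -
  have "(AE \<omega> in stable_steps \<alpha>. \<exists>n. walk_pos x \<omega> n \<in> A) \<longleftrightarrow> hit (stable_step \<alpha>) A x = 1" for x
    unfolding hit_def stable_steps_def
    using hit_sets prob_space.AE_iff_emeasure_eq_1[OF prob_space_steps, of "\<lambda>\<omega>. \<exists>n. walk_pos x \<omega> n \<in> A"]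
    by simp
  then show ?thesis by (simp add: stable_massive_def)
qed

section \<open>Potentials and hitting probabilities\<close>

lemma nn_integral_count_space_measure_pmf_swap:
  fixes F :: "pt \<Rightarrow> pt \<Rightarrow> ennreal"
  shows "(\<integral>\<^sup>+a. \<integral>\<^sup>+z. F a z \<partial>measure_pmf p \<partial>count_space A) = (\<integral>\<^sup>+z. \<integral>\<^sup>+a. F a z \<partial>count_space A \<partial>measure_pmf p)"
proof -
  let ?G = "\<lambda>(a, z). ennreal (pmf p z) * F a z * indicator A a"
  have "(\<integral>\<^sup>+a. \<integral>\<^sup>+z. F a z \<partial>measure_pmf p \<partial>count_space A) = (\<integral>\<^sup>+a. \<integral>\<^sup>+z. ?G (a, z) \<partial>count_space UNIV \<partial>count_space UNIV)"
    by (simp add: nn_integral_count_space_indicator nn_integral_measure_pmf nn_integral_multc)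
  also have "\<dots> = (\<integral>\<^sup>+z. \<integral>\<^sup>+a. ?G (a, z) \<partial>count_space UNIV \<partial>count_space UNIV)"
    unfolding nn_integral_fst_count_space nn_integral_snd_count_space ..
  also have "\<dots> = (\<integral>\<^sup>+z. \<integral>\<^sup>+a. F a z \<partial>count_space A \<partial>measure_pmf p)"
    by (simp add: nn_integral_count_space_indicator nn_integral_measure_pmf nn_integral_cmult mult.assoc)
  finally show ?thesis .
qed

lemma renewal_potential:
  fixes g :: "pt \<Rightarrow> ennreal"
  assumes g: "\<And>x. g x = indicator {0} x + (\<integral>\<^sup>+z. g (x + z) \<partial>measure_pmf p)"
  shows "(\<integral>\<^sup>+a. g (x - a) \<partial>count_space A) =
    indicator A x + (\<integral>\<^sup>+z. \<integral>\<^sup>+a. g (x + z - a) \<partial>count_space A \<partial>measure_pmf p)"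
proof -
  have "(\<integral>\<^sup>+a. g (x - a) \<partial>count_space A) =
      (\<integral>\<^sup>+a. indicator {0} (x - a) + (\<integral>\<^sup>+z. g (x + z - a) \<partial>measure_pmf p) \<partial>count_space A)"
  proof (intro nn_integral_cong)
    fix a
    have "x - a + z = x + z - a" for z by simp
    then show "g (x - a) = indicator {0} (x - a) + (\<integral>\<^sup>+z. g (x + z - a) \<partial>measure_pmf p)"
      using g[of "x - a"] by (simp only:)
  qed
  also have "\<dots> = (\<integral>\<^sup>+a. indicator {0} (x - a) \<partial>count_space A) +
      (\<integral>\<^sup>+z. \<integral>\<^sup>+a. g (x + z - a) \<partial>count_space A \<partial>measure_pmf p)"
    by (simp add: nn_integral_add nn_integral_count_space_measure_pmf_swap)
  also have "(\<integral>\<^sup>+a. indicator {0} (x - a) \<partial>count_space A) = (\<integral>\<^sup>+a. indicator A x * indicator {x} a \<partial>count_space UNIV)"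
    by (subst nn_integral_count_space_indicator, simp, rule nn_integral_cong) (auto split: split_indicator)
  also have "\<dots> = indicator A x"
    by (simp add: nn_integral_cmult)
  finally show ?thesis .
qed

text \<open>By induction on \<open>m\<close>, certain hitting forces at least \<open>m\<close> expected visits: the first visit is
  followed by a fresh start.\<close>

lemma certain_hit_imp_potential_infinite:
  fixes g :: "pt \<Rightarrow> ennreal"
  assumes g: "\<And>x. g x = indicator {0} x + (\<integral>\<^sup>+z. g (x + z) \<partial>measure_pmf p)"
    and hit: "\<And>x. hit p A x = 1"
  shows "(\<integral>\<^sup>+a. g (x - a) \<partial>count_space A) = \<infinity>"
proof -
  define f where "f x = (\<integral>\<^sup>+a. g (x - a) \<partial>count_space A)" for x
  have f: "f x = indicator A x + (\<integral>\<^sup>+z. f (x + z) \<partial>measure_pmf p)" for x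
    unfolding f_def by (rule renewal_potential[OF g])
  have "of_nat m \<le> f x" for m x
  proof (induction m arbitrary: x)
    case (Suc m)
    have inA: "of_nat (Suc m) \<le> f x" if "x \<in> A" for x
    proof -
      have "of_nat (Suc m) = 1 + (\<integral>\<^sup>+z. of_nat m \<partial>measure_pmf p)"
        by (simp add: measure_pmf.emeasure_space_1[simplified])
      also have "\<dots> \<le> 1 + (\<integral>\<^sup>+z. f (x + z) \<partial>measure_pmf p)"
        by (intro add_left_mono nn_integral_mono Suc)
      finally show ?thesis using f[of x] that by simp
    qed
    \<comment> \<open>Off A the potential equals its one-step average, and so does the hitting
      probability when the horizon drops by one. The bound \<open>inA\<close> therefore spreads from
      A to every starting point.\<close>
    have "of_nat (Suc m) * hit_by p A n x \<le> f x" for n x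
    proof (induction n arbitrary: x)
      case 0
      then show ?case using inA[of x] by (cases "x \<in> A") (auto simp: hit_by_in hit_by_0)
    next
      case (Suc n)
      show ?case
      proof (cases "x \<in> A")
        case True
        then show ?thesis using inA[of x] by (simp add: hit_by_in)
      next
        case False
        have "of_nat (Suc m) * hit_by p A (Suc n) x = (\<integral>\<^sup>+z. of_nat (Suc m) * hit_by p A n (x + z) \<partial>measure_pmf p)"
          using False by (simp add: hit_by_Suc nn_integral_cmult del: of_nat_Suc)
        also have "\<dots> \<le> (\<integral>\<^sup>+z. f (x + z) \<partial>measure_pmf p)"
          by (intro nn_integral_mono Suc)
        finally show ?thesis using f[of x] False by simp
      qed
    qed
    note le_n = this
    have "(\<lambda>n. of_nat (Suc m) * hit_by p A n x) \<longlonglongrightarrow> of_nat (Suc m) * hit p A x"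
      by (intro ennreal_tendsto_cmult hit_by_tendsto) (simp add: ennreal_of_nat_eq_real_of_nat del: of_nat_Suc)
    then have "of_nat (Suc m) * hit p A x \<le> f x"
      by (rule LIMSEQ_le_const2) (use le_n in blast)
    then show ?case by (simp add: hit)
  qed simp
  then have "f x = \<top>" by (metis ennreal_Ex_less_of_nat leD top.not_eq_extremum)
  then show ?thesis by (simp add: f_def)
qed

text \<open>With h the hitting probability, induction on n gives c + (1 - c) \<open>hit_by\<close>
  \<le> h: on A both sides are 1, off A both are one-step averages, and horizon 0 is the hypothesis.
  In the limit c + (1 - c) h \<le> h, which forces h = 1.\<close>

lemma hit_bounded_below_imp_certain:
  assumes c: "0 < c" "c \<le> 1" and "\<And>x. ennreal c \<le> hit p A x"
  shows "hit p A x = 1"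
proof -
  have c1: "ennreal c + ennreal (1 - c) = 1"
    using c by (subst ennreal_plus[symmetric]) auto
  have "ennreal c + ennreal (1 - c) * hit_by p A n x \<le> hit p A x" for n x
  proof (induction n arbitrary: x)
    case 0
    then show ?case using assms(3)[of x] by (cases "x \<in> A") (auto simp: hit_by_in hit_by_0 hit_in c1)
  next
    case (Suc n)
    show ?case
    proof (cases "x \<in> A")
      case True
      then show ?thesis by (simp add: hit_by_in hit_in c1)
    next
      case False
      have "ennreal c + ennreal (1 - c) * hit_by p A (Suc n) x =
          (\<integral>\<^sup>+z. ennreal c + ennreal (1 - c) * hit_by p A n (x + z) \<partial>measure_pmf p)"
        using False by (simp add: hit_by_Suc nn_integral_cmult nn_integral_add measure_pmf.emeasure_space_1[simplified])
      also have "\<dots> \<le> (\<integral>\<^sup>+z. hit p A (x + z) \<partial>measure_pmf p)"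
        by (intro nn_integral_mono Suc)
      finally show ?thesis using False by (simp add: hit_not_in[of x])
    qed
  qed
  note le_n = this
  have "(\<lambda>n. ennreal c + ennreal (1 - c) * hit_by p A n x) \<longlonglongrightarrow> ennreal c + ennreal (1 - c) * hit p A x"
    by (intro tendsto_add tendsto_const ennreal_tendsto_cmult hit_by_tendsto) simp
  then have le: "ennreal c + ennreal (1 - c) * hit p A x \<le> hit p A x"
    by (rule LIMSEQ_le_const2) (use le_n in blast)
  obtain r where r: "hit p A x = ennreal r" "0 \<le> r"
    using hit_le_1[of p A x] by (cases "hit p A x") (auto simp: top_unique)
  have "ennreal (c + (1 - c) * r) \<le> ennreal r"
    using le c r by (simp add: ennreal_plus ennreal_mult)
  then have "c + (1 - c) * r \<le> r" using r(2) by (simp add: ennreal_le_iff)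
  then have "c * 1 \<le> c * r" by (simp add: algebra_simps)
  then have "1 \<le> r" using c by (simp only: mult_le_cancel_left_pos)
  then show ?thesis using hit_le_1[of p A x] r by (simp add: order_antisym)
qed

section \<open>Decay at infinity and the maximum principle\<close>

lemma finite_maxnorm_le: "finite {z. maxnorm z \<le> R}"
proof (rule finite_subset)
  show "{z. maxnorm z \<le> R} \<subseteq> {- int R..int R} \<times> {- int R..int R}"
    by (auto simp: maxnorm_le_iff)
qed simp

lemma riesz_tendsto_0: "\<alpha> < 2 \<Longrightarrow> riesz \<alpha> \<longlonglongrightarrow> 0"
proof -
  assume "\<alpha> < 2"
  then have "(\<lambda>r. real r powr (\<alpha> - 2)) \<longlonglongrightarrow> 0"
    by (intro tendsto_neg_powr filterlim_real_sequentially) auto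
  moreover have "\<forall>\<^sub>F r in sequentially. real r powr (\<alpha> - 2) = riesz \<alpha> r"
    using eventually_ge_at_top[of 1] by eventually_elim (simp add: riesz_def max_def)
  ultimately show ?thesis by (rule Lim_transform_eventually)
qed

text \<open>Vanishing at infinity, put in the form needed to know that a positive supremum is
  attained.\<close>

lemma finite_green_ge:
  assumes "0 < \<alpha>" "\<alpha> < 2" "0 < e"
  shows "finite {z. e \<le> green \<alpha> z}"
proof -
  obtain C where C: "0 < C" "\<And>z. green \<alpha> z \<le> C * riesz \<alpha> (maxnorm z)"
    using green_upper assms by blast
  have "\<forall>\<^sub>F r in sequentially. riesz \<alpha> r < e / C"
    using riesz_tendsto_0[OF assms(2)] assms(3) C(1) by (intro order_tendstoD(2)[where y = 0]) auto
  then obtain R where R: "\<And>r. r \<ge> R \<Longrightarrow> riesz \<alpha> r < e / C"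
    by (auto simp: eventually_sequentially)
  have "maxnorm z \<le> R" if "e \<le> green \<alpha> z" for z
  proof (rule ccontr)
    assume "\<not> maxnorm z \<le> R"
    then have "C * riesz \<alpha> (maxnorm z) < e" using R[of "maxnorm z"] C(1) by (simp add: field_simps)
    then show False using C(2)[of z] that by simp
  qed
  then have "{z. e \<le> green \<alpha> z} \<subseteq> {z. maxnorm z \<le> R}" by auto
  then show ?thesis using finite_maxnorm_le finite_subset by blast
qed

lemma finite_green_potential_ge:
  assumes "0 < \<alpha>" "\<alpha> < 2" "0 < e" "finite B"
  shows "finite {y. e \<le> (\<Sum>b\<in>B. green \<alpha> (y - b))}"
proof (cases "B = {}")
  case True
  then show ?thesis using assms by simp
next
  case False
  then have cB: "0 < card B" using assms by (simp add: card_gt_0_iff)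
  have "{y. e \<le> (\<Sum>b\<in>B. green \<alpha> (y - b))} \<subseteq> (\<Union>b\<in>B. (\<lambda>z. z + b) ` {z. e / card B \<le> green \<alpha> z})"
  proof
    fix y assume y: "y \<in> {y. e \<le> (\<Sum>b\<in>B. green \<alpha> (y - b))}"
    have "\<exists>b\<in>B. e / card B \<le> green \<alpha> (y - b)"
    proof (rule ccontr)
      assume "\<not> ?thesis"
      then have "(\<Sum>b\<in>B. green \<alpha> (y - b)) < (\<Sum>b\<in>B. e / card B)"
        using False assms by (intro sum_strict_mono) auto
      then show False using y cB by simp
    qed
    then obtain b where "b \<in> B" "e / card B \<le> green \<alpha> (y - b)" by blast
    then show "y \<in> (\<Union>b\<in>B. (\<lambda>z. z + b) ` {z. e / card B \<le> green \<alpha> z})"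
      by (auto intro!: bexI[of _ b] image_eqI[of _ _ "y - b"])
  qed
  moreover have "finite (\<Union>b\<in>B. (\<lambda>z. z + b) ` {z. e / card B \<le> green \<alpha> z})"
    using assms cB by (intro finite_UN_I finite_imageI finite_green_ge) auto
  ultimately show ?thesis by (rule finite_subset)
qed

text \<open>Maximum principle for v = f - M H, with f the potential of B and H its hitting
  probability. Off B, v equals its one-step average; on B, H = 1 and v \<le> 0. As v \<le> f and f
  vanishes at infinity, a positive supremum would be attained on a finite set, off B.\<close>

lemma green_potential_le_hit:
  fixes B :: "pt set"
  assumes \<alpha>: "0 < \<alpha>" "\<alpha> < 2" and B: "finite B"
    and M: "\<And>a. a \<in> B \<Longrightarrow> (\<Sum>b\<in>B. green \<alpha> (a - b)) \<le> M" "0 \<le> M"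
  shows "(\<Sum>b\<in>B. green \<alpha> (x - b)) \<le> M * enn2real (hit (stable_step \<alpha>) B x)"
proof (rule ccontr)
  define p where "p = stable_step \<alpha>"
  define f where "f y = (\<Sum>b\<in>B. green \<alpha> (y - b))" for y
  define H where "H y = enn2real (hit p B y)" for y
  define v where "v y = f y - M * H y" for y
  have hitH: "hit p B y = ennreal (H y)" "0 \<le> H y" "H y \<le> 1" for y
    using hit_le_1[of p B y] by (auto simp: H_def ennreal_enn2real_if enn2real_leI top_unique)
  obtain C where C: "0 < C" "\<And>z. green \<alpha> z \<le> C * riesz \<alpha> (maxnorm z)"
    using green_upper \<alpha> by blast
  have f0: "0 \<le> f y" for y unfolding f_def using green_nonneg[OF \<alpha>] by (intro sum_nonneg) auto
  have f1: "f y \<le> card B * C" for y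
  proof -
    have "green \<alpha> z \<le> C" for z
      using order_trans[OF C(2)[of z] mult_left_mono[OF riesz_le_1[OF \<alpha>(2)]]] C(1) by simp
    then show ?thesis unfolding f_def using sum_bounded_above[of B "\<lambda>b. green \<alpha> (y - b)" C] by simp
  qed
  have fpot: "ennreal (f y) = (\<integral>\<^sup>+a. ennreal (green \<alpha> (y - a)) \<partial>count_space B)" for y
    unfolding f_def using B green_nonneg[OF \<alpha>] by (simp add: nn_integral_count_space_finite)
  have fT: "ennreal (f y) = (\<integral>\<^sup>+z. ennreal (f (y + z)) \<partial>measure_pmf p)" if "y \<notin> B" for y
    using renewal_potential[where g = "\<lambda>z. ennreal (green \<alpha> z)" and x = y and A = B, OF green_renewal[OF \<alpha>, folded p_def]] that
    by (simp add: fpot)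
  have HT: "ennreal (H y) = (\<integral>\<^sup>+z. ennreal (H (y + z)) \<partial>measure_pmf p)" if "y \<notin> B" for y
    using hit_not_in[OF that, of p] by (simp add: hitH(1))
  \<comment> \<open>Since v may change sign, its mean value property needs the Bochner integral, and
    hence the bounds on f and H.\<close>
  have int: "integrable (measure_pmf p) (\<lambda>z. f (y + z))" "integrable (measure_pmf p) (\<lambda>z. H (y + z))" for y
  proof -
    show "integrable (measure_pmf p) (\<lambda>z. f (y + z))"
      by (rule measure_pmf.integrable_const_bound[where B = "card B * C"]) (use f0 f1 in auto)
    show "integrable (measure_pmf p) (\<lambda>z. H (y + z))"
      by (rule measure_pmf.integrable_const_bound[where B = 1]) (use hitH in auto)
  qed
  have vT: "v y = (\<integral>z. v (y + z) \<partial>measure_pmf p)" if "y \<notin> B" for y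
  proof -
    have "f y = (\<integral>z. f (y + z) \<partial>measure_pmf p)"
      using fT[OF that] int(1)[of y] f0 by (simp add: nn_integral_eq_integral)
    moreover have "H y = (\<integral>z. H (y + z) \<partial>measure_pmf p)"
      using HT[OF that] int(2)[of y] hitH(2) by (simp add: nn_integral_eq_integral)
    ultimately show ?thesis using int[of y] by (simp add: v_def)
  qed
  assume "\<not> ?thesis"
  then have x: "0 < v x" by (simp add: v_def f_def H_def p_def)
  define S where "S = {y. v x \<le> v y}"
  have "S \<subseteq> {y. v x \<le> f y}"
    using M(2) hitH(2) by (auto simp: S_def v_def intro: order_trans)
  then have S: "finite S" using finite_green_potential_ge[OF \<alpha> x B] finite_subset by (auto simp: f_def)
  define s where "s = Max (v ` S)"
  have "s \<in> v ` S" using S by (auto simp: s_def S_def intro!: Max_in)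
  then have sx: "v x \<le> s" by (auto simp: S_def)
  have vs: "v y \<le> s" for y
  proof (cases "y \<in> S")
    case True
    then show ?thesis using S by (simp add: s_def)
  next
    case False
    then show ?thesis using sx by (simp add: S_def)
  qed
  define Z where "Z = {y. v y = s}"
  have Z: "finite Z" "Z \<noteq> {}"
    using S sx \<open>s \<in> v ` S\<close> by (auto simp: Z_def S_def elim: rev_finite_subset)
  \<comment> \<open>A rightmost maximiser is chosen: equality in the mean value property makes y +
    (1, 0) a maximiser as well, contradicting the choice.\<close>
  have "Max (fst ` Z) \<in> fst ` Z" using Z by (intro Max_in) auto
  then obtain y where y: "y \<in> Z" "fst y = Max (fst ` Z)" by auto
  have "y + (1, 0) \<notin> Z"
  proof
    assume "y + (1, 0) \<in> Z"
    then have "fst (y + (1, 0)) \<le> Max (fst ` Z)" using Z by (intro Max_ge finite_imageI imageI)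
    then show False using y by simp
  qed
  have "y \<notin> B"
  proof
    assume "y \<in> B"
    then have "v y \<le> 0" using M(1)[of y] by (simp add: v_def f_def H_def hit_in)
    then show False using y x sx by (simp add: Z_def)
  qed
  have iv: "integrable (measure_pmf p) (\<lambda>z. s - v (y + z))"
    using int[of y] by (simp add: v_def)
  have "(\<integral>z. s - v (y + z) \<partial>measure_pmf p) = s - v y"
    using int[of y] vT[OF \<open>y \<notin> B\<close>] by (subst Bochner_Integration.integral_diff) (auto simp: v_def)
  then have "(\<integral>z. s - v (y + z) \<partial>measure_pmf p) = 0" using y by (simp add: Z_def)
  then have "AE z in measure_pmf p. s - v (y + z) = 0"
    using integral_nonneg_eq_0_iff_AE[OF iv] vs by simp
  moreover have "(1, 0) \<in> set_pmf p"
    using pmf_stable_step_right_pos[OF \<alpha>] by (simp add: p_def set_pmf_iff)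
  ultimately have "s - v (y + (1, 0)) = 0" by (auto simp: AE_measure_pmf_iff)
  then show False using \<open>y + (1, 0) \<notin> Z\<close> by (simp add: Z_def)
qed

section \<open>Superlinear sets\<close>

text \<open>The origin is left out because the series omits it and radial boundedness speaks only of
  positive radii.\<close>

definition annulus :: "pt set \<Rightarrow> nat \<Rightarrow> pt set" where
  "annulus A R = {a \<in> A. 0 < maxnorm a \<and> maxnorm a \<le> R}"

lemma finite_annulus: "finite (annulus A R)"
  by (rule finite_subset[OF _ finite_maxnorm_le[of R]]) (auto simp: annulus_def)

definition riesz_sum :: "real \<Rightarrow> pt set \<Rightarrow> nat \<Rightarrow> real" where
  "riesz_sum \<alpha> A R = (\<Sum>a\<in>annulus A R. riesz \<alpha> (maxnorm a))"

lemma nn_integral_riesz_eq_SUP: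
  "(\<integral>\<^sup>+ a. ennreal (1 / (real (maxnorm a) powr (2 - \<alpha>))) \<partial>count_space (A - {(0, 0)})) =
    (SUP R. ennreal (riesz_sum \<alpha> A R))"
proof -
  let ?f = "\<lambda>R a. ennreal (riesz \<alpha> (maxnorm a)) * indicator (annulus A R) a"
  have "(\<integral>\<^sup>+ a. ennreal (1 / (real (maxnorm a) powr (2 - \<alpha>))) \<partial>count_space (A - {(0, 0)})) =
      (\<integral>\<^sup>+ a. (SUP R. ?f R a) \<partial>count_space UNIV)"
  proof (subst nn_integral_count_space_indicator, simp, rule nn_integral_cong)
    fix a :: pt
    show "ennreal (1 / (real (maxnorm a) powr (2 - \<alpha>))) * indicator (A - {(0, 0)}) a = (SUP R. ?f R a)"
    proof (cases "a \<in> A - {(0, 0)}")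
      case True
      then have "a \<noteq> 0" and a: "a \<in> A" by (auto simp: zero_prod_def)
      then have "1 \<le> maxnorm a" by (simp add: Suc_le_eq)
      have "(SUP R. ?f R a) = ennreal (riesz \<alpha> (maxnorm a))"
      proof (intro antisym SUP_least)
        show "ennreal (riesz \<alpha> (maxnorm a)) \<le> (SUP R. ?f R a)"
          by (rule SUP_upper2[of "maxnorm a"]) (use a \<open>a \<noteq> 0\<close> in \<open>auto simp: annulus_def\<close>)
      qed (auto split: split_indicator)
      moreover have "riesz \<alpha> (maxnorm a) = 1 / (real (maxnorm a) powr (2 - \<alpha>))"
        using \<open>1 \<le> maxnorm a\<close> powr_minus_divide[of "real (maxnorm a)" "2 - \<alpha>"] by (simp add: riesz_def max_def)
      ultimately show ?thesis using True by simp
    next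
      case False
      then have zero: "?f R a = 0" for R by (auto simp: annulus_def zero_prod_def[symmetric] split: split_indicator)
      show ?thesis unfolding zero using False by simp
    qed
  qed
  also have "\<dots> = (SUP R. \<integral>\<^sup>+ a. ?f R a \<partial>count_space UNIV)"
    by (rule nn_integral_monotone_convergence_SUP)
      (auto simp: incseq_def le_fun_def annulus_def split: split_indicator)
  also have "\<dots> = (SUP R. ennreal (riesz_sum \<alpha> A R))"
  proof (intro arg_cong[where f = Sup] image_cong refl)
    fix R
    have "(\<integral>\<^sup>+ a. ?f R a \<partial>count_space UNIV) = (\<integral>\<^sup>+ a. ennreal (riesz \<alpha> (maxnorm a)) \<partial>count_space (annulus A R))"
      by (simp add: nn_integral_count_space_indicator)
    also have "\<dots> = ennreal (riesz_sum \<alpha> A R)"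
      by (simp add: nn_integral_count_space_finite[OF finite_annulus] riesz_sum_def sum_ennreal less_imp_le[OF riesz_pos])
    finally show "(\<integral>\<^sup>+ a. ?f R a \<partial>count_space UNIV) = ennreal (riesz_sum \<alpha> A R)" .
  qed
  finally show ?thesis .
qed

lemma nn_integral_riesz_infinite_iff:
  "(\<integral>\<^sup>+ a. ennreal (1 / (real (maxnorm a) powr (2 - \<alpha>))) \<partial>count_space (A - {(0, 0)})) = \<infinity>
    \<longleftrightarrow> (\<forall>K. \<exists>R. K \<le> riesz_sum \<alpha> A R)"
  unfolding nn_integral_riesz_eq_SUP
proof
  assume inf: "(SUP R. ennreal (riesz_sum \<alpha> A R)) = \<infinity>"
  show "\<forall>K. \<exists>R. K \<le> riesz_sum \<alpha> A R"
  proof (rule ccontr)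
    assume "\<not> ?thesis"
    then obtain K where "\<And>R. riesz_sum \<alpha> A R \<le> K" by (force simp: not_le intro: less_imp_le)
    then have "(SUP R. ennreal (riesz_sum \<alpha> A R)) \<le> ennreal K"
      by (intro SUP_least ennreal_leI)
    then show False using inf by (simp add: top_unique)
  qed
next
  assume K: "\<forall>K. \<exists>R. K \<le> riesz_sum \<alpha> A R"
  have "of_nat n \<le> (SUP R. ennreal (riesz_sum \<alpha> A R))" for n
  proof -
    obtain R where "real n \<le> riesz_sum \<alpha> A R" using K by blast
    then have "of_nat n \<le> ennreal (riesz_sum \<alpha> A R)"
      by (simp add: ennreal_of_nat_eq_real_of_nat ennreal_leI)
    then show ?thesis by (rule SUP_upper2[OF UNIV_I])
  qed
  then show "(SUP R. ennreal (riesz_sum \<alpha> A R)) = \<infinity>"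
    by (metis ennreal_Ex_less_of_nat leD top.not_eq_extremum infinity_ennreal_def)
qed

text \<open>The shift by 1 comes from indexing: e starts at 0, while \<open>norm_seq\<close> starts
  at 1. The hypothesis is used for n = i + 1 and k = i - j, whose terms a_(j+1) and a_(i-j) are e j
  and e (i - j - 1).\<close>

lemma superlinear_enumeration:
  assumes "superlinear A" "infinite (maxnorm ` A)"
  obtains e :: "nat \<Rightarrow> nat" where "strict_mono e" "range e = maxnorm ` A"
    "\<And>i j. j < i \<Longrightarrow> e j + e (i - j - 1) \<le> e i"
proof
  let ?e = "enumerate (maxnorm ` A)"
  show "strict_mono ?e" using assms(2) by (rule strict_mono_enumerate)
  show "range ?e = maxnorm ` A" using assms(2) by (rule range_enumerate)
  fix i j :: nat assume "j < i"
  then have "norm_seq A (Suc i - (i - j)) + norm_seq A (i - j) \<le> norm_seq A (Suc i)"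
    using assms unfolding superlinear_def by (metis diff_is_0_eq leD less_SucI neq0_conv zero_less_diff diff_less_Suc less_Suc_eq_le)
  moreover have "Suc i - (i - j) - 1 = j" using \<open>j < i\<close> by simp
  ultimately show "?e j + ?e (i - j - 1) \<le> ?e i"
    using assms(2) by (simp add: norm_seq_def)
qed

text \<open>Distances are bounded below by differences of norms, and each radius carries at most N
  points. With e k the norm of a, superlinearity bounds |e k - e i| below by e at the index |k - i|
  - 1. The indices on each side of k thus inject into those of the original sum. The 3 counts the
  radius of a itself and a possible radius 0 on each side.\<close>

lemma riesz_interaction_le:
  assumes \<alpha>: "\<alpha> < 2" and sl: "superlinear A" "infinite (maxnorm ` A)"
    and N: "\<And>r. 0 < r \<Longrightarrow> card {a \<in> A. maxnorm a = r} \<le> N"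
    and a: "a \<in> annulus A R"
  shows "(\<Sum>b\<in>annulus A R. riesz \<alpha> (maxnorm (a - b))) \<le> real N * (3 + 2 * riesz_sum \<alpha> A R)"
proof -
  obtain e :: "nat \<Rightarrow> nat" where e: "strict_mono e" "range e = maxnorm ` A"
    and sup: "\<And>i j. j < i \<Longrightarrow> e j + e (i - j - 1) \<le> e i"
    using superlinear_enumeration[OF sl] by blast
  define B where "B = annulus A R"
  have B: "finite B" "a \<in> B" using finite_annulus a by (auto simp: B_def)
  define I where "I = {i. 0 < e i \<and> e i \<le> R}"
  define J where "J = {i. e i \<le> R}"
  have eJ: "inj e" using e(1) by (rule strict_mono_imp_inj_on)
  have J: "finite J"
    by (rule finite_subset[of _ "{..R}"]) (auto simp: J_def intro: order_trans[OF strict_mono_imp_increasing[OF e(1)]])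
  have IJ: "I \<subseteq> J" by (auto simp: I_def J_def)
  have I: "finite I" using IJ J by (rule finite_subset)
  have normB: "maxnorm ` B = e ` I"
  proof
    show "maxnorm ` B \<subseteq> e ` I"
    proof
      fix r assume "r \<in> maxnorm ` B"
      then have "r \<in> range e" "0 < r" "r \<le> R" by (auto simp: B_def annulus_def e(2))
      then show "r \<in> e ` I" by (auto simp: I_def)
    qed
    show "e ` I \<subseteq> maxnorm ` B"
    proof
      fix r assume "r \<in> e ` I"
      then have "r \<in> maxnorm ` A" "0 < r" "r \<le> R" by (auto simp: I_def e(2)[symmetric])
      then show "r \<in> maxnorm ` B" by (auto simp: B_def annulus_def)
    qed
  qed
  have "(\<Sum>i\<in>I. riesz \<alpha> (e i)) = (\<Sum>r\<in>maxnorm ` B. riesz \<alpha> r)"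
    unfolding normB using eJ by (simp add: sum.reindex inj_on_subset)
  also have "\<dots> \<le> (\<Sum>b\<in>B. riesz \<alpha> (maxnorm b))"
    using sum_image_le[OF B(1), of "riesz \<alpha>" maxnorm] riesz_pos by (simp add: less_imp_le)
  finally have sumI: "(\<Sum>i\<in>I. riesz \<alpha> (e i)) \<le> riesz_sum \<alpha> A R" by (simp add: riesz_sum_def B_def)
  have "(\<Sum>i\<in>J. riesz \<alpha> (e i)) = (\<Sum>i\<in>J - I. riesz \<alpha> (e i)) + (\<Sum>i\<in>I. riesz \<alpha> (e i))"
    using J IJ by (rule sum.subset_diff[rotated])
  also have "(\<Sum>i\<in>J - I. riesz \<alpha> (e i)) \<le> (\<Sum>i\<in>{0::nat}. 1)"
  proof -
    have "J - I \<subseteq> {0}"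
    proof
      fix i assume "i \<in> J - I"
      then have "e i = 0" by (auto simp: I_def J_def)
      then show "i \<in> {0}" using strict_mono_imp_increasing[OF e(1), of i] by simp
    qed
    then have "(\<Sum>i\<in>J - I. riesz \<alpha> (e i)) \<le> (\<Sum>i\<in>{0}. riesz \<alpha> (e i))"
      by (intro sum_mono2) (auto simp: less_imp_le[OF riesz_pos])
    also have "\<dots> \<le> (\<Sum>i\<in>{0::nat}. 1)" using riesz_le_1[OF \<alpha>] by (intro sum_mono)
    finally show ?thesis .
  qed
  finally have sumJ: "(\<Sum>i\<in>J. riesz \<alpha> (e i)) \<le> 1 + riesz_sum \<alpha> A R" using sumI by simp
  have "maxnorm a \<in> e ` I" using B(2) normB by blast
  then obtain k where k: "k \<in> I" "maxnorm a = e k" by blast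
  \<comment> \<open>The maximum of the two truncated differences is the absolute difference of
    natural numbers.\<close>
  define F where "F r = riesz \<alpha> (max (e k - r) (r - e k))" for r
  have F0: "0 \<le> F r" for r by (simp add: F_def less_imp_le[OF riesz_pos])
  have "(\<Sum>b\<in>B. riesz \<alpha> (maxnorm (a - b))) \<le> (\<Sum>b\<in>B. F (maxnorm b))"
    unfolding F_def k(2)[symmetric]
    by (intro sum_mono riesz_antimono[OF \<alpha>] max.boundedI maxnorm_diff_ge) (metis maxnorm_diff_ge maxnorm_commute)
  also have "\<dots> = (\<Sum>r\<in>maxnorm ` B. \<Sum>b\<in>{b \<in> B. maxnorm b = r}. F (maxnorm b))"
    using B(1) by (rule sum.image_gen)
  also have "\<dots> \<le> (\<Sum>r\<in>maxnorm ` B. real N * F r)"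
  proof (rule sum_mono)
    fix r assume "r \<in> maxnorm ` B"
    then have r: "0 < r" by (auto simp: B_def annulus_def)
    have "card {b \<in> B. maxnorm b = r} \<le> card {b \<in> A. maxnorm b = r}"
      by (rule card_mono) (auto simp: B_def annulus_def intro: finite_subset[OF _ finite_maxnorm_le[of r]])
    then have "real (card {b \<in> B. maxnorm b = r}) \<le> real N" using N[OF r] by simp
    then show "(\<Sum>b\<in>{b \<in> B. maxnorm b = r}. F (maxnorm b)) \<le> real N * F r"
      using F0[of r] by (simp add: mult_right_mono)
  qed
  also have "\<dots> = real N * (\<Sum>i\<in>I. F (e i))"
    unfolding normB sum_distrib_left using eJ by (simp add: sum.reindex inj_on_subset)
  also have "(\<Sum>i\<in>I. F (e i)) \<le> 1 + 2 * (1 + riesz_sum \<alpha> A R)"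
  proof -
    have split: "I = {k} \<union> ({i \<in> I. i < k} \<union> {i \<in> I. k < i})" using k(1) by auto
    have eq: "(\<Sum>i\<in>I. F (e i)) = F (e k) + ((\<Sum>i\<in>{i \<in> I. i < k}. F (e i)) + (\<Sum>i\<in>{i \<in> I. k < i}. F (e i)))"
      using I by (subst split) (subst sum.union_disjoint; auto simp: sum.union_disjoint)+
    have at: "F (e k) \<le> 1" using riesz_le_1[OF \<alpha>] by (simp add: F_def)
    \<comment> \<open>The reindexing i to k - i - 1 is injective and stays within J because e
      increases; the indices above k are treated symmetrically.\<close>
    have below: "(\<Sum>i\<in>{i \<in> I. i < k}. F (e i)) \<le> (\<Sum>i\<in>J. riesz \<alpha> (e i))"
    proof -
      have "(\<Sum>i\<in>{i \<in> I. i < k}. F (e i)) \<le> (\<Sum>i\<in>{i \<in> I. i < k}. riesz \<alpha> (e (k - i - 1)))"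
        unfolding F_def
      proof (intro sum_mono riesz_antimono[OF \<alpha>])
        fix i assume "i \<in> {i \<in> I. i < k}"
        then show "e (k - i - 1) \<le> max (e k - e i) (e i - e k)" using sup[of i k] by simp
      qed
      also have "\<dots> = (\<Sum>j\<in>(\<lambda>i. k - i - 1) ` {i \<in> I. i < k}. riesz \<alpha> (e j))"
        by (subst sum.reindex) (auto simp: inj_on_def)
      also have "\<dots> \<le> (\<Sum>i\<in>J. riesz \<alpha> (e i))"
      proof (rule sum_mono2[OF J])
        show "(\<lambda>i. k - i - 1) ` {i \<in> I. i < k} \<subseteq> J"
        proof
          fix j assume "j \<in> (\<lambda>i. k - i - 1) ` {i \<in> I. i < k}"
          then have "e j \<le> e k" by (intro strict_mono_leD[OF e(1)]) auto
          then show "j \<in> J" using k(1) by (simp add: I_def J_def)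
        qed
      qed (auto simp: less_imp_le[OF riesz_pos])
      finally show ?thesis .
    qed
    have above: "(\<Sum>i\<in>{i \<in> I. k < i}. F (e i)) \<le> (\<Sum>i\<in>J. riesz \<alpha> (e i))"
    proof -
      have "(\<Sum>i\<in>{i \<in> I. k < i}. F (e i)) \<le> (\<Sum>i\<in>{i \<in> I. k < i}. riesz \<alpha> (e (i - k - 1)))"
        unfolding F_def
      proof (intro sum_mono riesz_antimono[OF \<alpha>])
        fix i assume "i \<in> {i \<in> I. k < i}"
        then show "e (i - k - 1) \<le> max (e k - e i) (e i - e k)" using sup[of k i] by simp
      qed
      also have "\<dots> = (\<Sum>j\<in>(\<lambda>i. i - k - 1) ` {i \<in> I. k < i}. riesz \<alpha> (e j))"
        by (subst sum.reindex) (auto simp: inj_on_def)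
      also have "\<dots> \<le> (\<Sum>i\<in>J. riesz \<alpha> (e i))"
      proof (rule sum_mono2[OF J])
        show "(\<lambda>i. i - k - 1) ` {i \<in> I. k < i} \<subseteq> J"
        proof
          fix j assume "j \<in> (\<lambda>i. i - k - 1) ` {i \<in> I. k < i}"
          then obtain i where i: "i \<in> I" "j = i - k - 1" by blast
          then have "e j \<le> e i" by (intro strict_mono_leD[OF e(1)]) simp
          then show "j \<in> J" using i(1) by (simp add: I_def J_def)
        qed
      qed (auto simp: less_imp_le[OF riesz_pos])
      finally show ?thesis .
    qed
    show ?thesis
      unfolding eq by (rule order_trans[OF add_mono[OF at add_mono[OF below above]]]) (use sumJ in simp)
  qed
  finally show ?thesis
    by (simp add: B_def mult_left_mono)
qed

text \<open>Small norms cost at most one per lattice point of a box. This error does not depend on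
  R, so divergence makes it negligible.\<close>

lemma riesz_sum_near_le:
  assumes "\<alpha> < 2"
  shows "riesz_sum \<alpha> A R \<le> (\<Sum>b\<in>{b \<in> annulus A R. m \<le> maxnorm b}. riesz \<alpha> (maxnorm b)) + card {z. maxnorm z \<le> m}"
proof -
  have "riesz_sum \<alpha> A R = (\<Sum>b\<in>annulus A R - {b \<in> annulus A R. m \<le> maxnorm b}. riesz \<alpha> (maxnorm b)) +
      (\<Sum>b\<in>{b \<in> annulus A R. m \<le> maxnorm b}. riesz \<alpha> (maxnorm b))"
    unfolding riesz_sum_def by (rule sum.subset_diff[OF _ finite_annulus]) auto
  moreover have "(\<Sum>b\<in>annulus A R - {b \<in> annulus A R. m \<le> maxnorm b}. riesz \<alpha> (maxnorm b)) \<le> (\<Sum>b\<in>{z. maxnorm z \<le> m}. 1)"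
  proof -
    have "(\<Sum>b\<in>annulus A R - {b \<in> annulus A R. m \<le> maxnorm b}. riesz \<alpha> (maxnorm b)) \<le>
        (\<Sum>b\<in>{z. maxnorm z \<le> m}. riesz \<alpha> (maxnorm b))"
      by (intro sum_mono2 finite_maxnorm_le) (auto simp: less_imp_le[OF riesz_pos])
    also have "\<dots> \<le> (\<Sum>b\<in>{z. maxnorm z \<le> m}. 1)" by (intro sum_mono riesz_le_1 assms)
    finally show ?thesis .
  qed
  ultimately show ?thesis by simp
qed

text \<open>With s the partial sum, the potential of B is at least c s / 2 at x and at most 5 C N s
  on B, so the hitting probability is at least c / (10 C N). Only the size of B depends on
  x.\<close>

lemma hit_bounded_below:
  assumes \<alpha>: "0 < \<alpha>" "\<alpha> < 2" and rb: "radially_bounded A" and sl: "superlinear A"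
    and div: "\<And>K. \<exists>R. K \<le> riesz_sum \<alpha> A R"
  obtains c where "0 < c" "\<And>x. ennreal c \<le> hit (stable_step \<alpha>) A x"
proof -
  obtain C where C: "0 < C" "\<And>z. green \<alpha> z \<le> C * riesz \<alpha> (maxnorm z)"
    using green_upper \<alpha> by blast
  obtain c where c: "0 < c" "\<And>z r. 1 \<le> r \<Longrightarrow> maxnorm z \<le> 2 * r \<Longrightarrow> c * riesz \<alpha> r \<le> green \<alpha> z"
    using green_lower \<alpha> by blast
  obtain N where N: "0 < N" "\<And>r. 0 < r \<Longrightarrow> card {a \<in> A. maxnorm a = r} \<le> N"
    using rb by (auto simp: radially_bounded_def)
  \<comment> \<open>A bounded set of norms would confine A to a box and bound all partial sums; an
    infinite set of norms is what the enumeration requires.\<close>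
  have inf: "infinite (maxnorm ` A)"
  proof
    assume "finite (maxnorm ` A)"
    then obtain m where m: "\<And>a. a \<in> A \<Longrightarrow> maxnorm a \<le> m" by (auto simp: finite_nat_set_iff_bounded_le)
    have "riesz_sum \<alpha> A R \<le> card {z. maxnorm z \<le> m}" for R
    proof -
      have "riesz_sum \<alpha> A R \<le> (\<Sum>b\<in>{z. maxnorm z \<le> m}. riesz \<alpha> (maxnorm b))"
        unfolding riesz_sum_def using m
        by (intro sum_mono2 finite_maxnorm_le) (auto simp: annulus_def less_imp_le[OF riesz_pos])
      also have "\<dots> \<le> (\<Sum>b\<in>{z. maxnorm z \<le> m}. 1)" by (intro sum_mono riesz_le_1 \<alpha>)
      finally show ?thesis by simp
    qed
    then show False using div[of "real (card {z. maxnorm z \<le> m}) + 1"] by (smt (verit))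
  qed
  have "ennreal (c / (10 * C * N)) \<le> hit (stable_step \<alpha>) A x" for x
  proof -
    define K where "K = real (card {z. maxnorm z \<le> maxnorm x})"
    \<comment> \<open>This size gives s \<ge> 1 and K \<le> s / 2: at least half of the sum comes
      from points no closer to the origin than x, where the lower Green bound applies.\<close>
    obtain R where R: "2 * K + 1 \<le> riesz_sum \<alpha> A R" using div by blast
    define s where "s = riesz_sum \<alpha> A R"
    define B where "B = annulus A R"
    have s: "1 \<le> s" "K \<le> s / 2" using R unfolding s_def[symmetric] K_def by simp_all
    have lower: "c * s / 2 \<le> (\<Sum>b\<in>B. green \<alpha> (x - b))"
    proof -
      have "s / 2 \<le> s - K" using s by simp
      also have "\<dots> \<le> (\<Sum>b\<in>{b \<in> B. maxnorm x \<le> maxnorm b}. riesz \<alpha> (maxnorm b))"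
        using riesz_sum_near_le[OF \<alpha>(2), of A R "maxnorm x"] by (simp add: s_def K_def B_def)
      finally have "c * (s / 2) \<le> c * (\<Sum>b\<in>{b \<in> B. maxnorm x \<le> maxnorm b}. riesz \<alpha> (maxnorm b))"
        using c(1) by (simp add: mult_left_mono)
      also have "\<dots> = (\<Sum>b\<in>{b \<in> B. maxnorm x \<le> maxnorm b}. c * riesz \<alpha> (maxnorm b))"
        by (rule sum_distrib_left)
      also have "\<dots> \<le> (\<Sum>b\<in>{b \<in> B. maxnorm x \<le> maxnorm b}. green \<alpha> (x - b))"
      proof (intro sum_mono c(2))
        fix b assume b: "b \<in> {b \<in> B. maxnorm x \<le> maxnorm b}"
        then show "1 \<le> maxnorm b" by (auto simp: B_def annulus_def Suc_le_eq)
        show "maxnorm (x - b) \<le> 2 * maxnorm b" using b maxnorm_diff_le[of x b] by simp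
      qed
      also have "\<dots> \<le> (\<Sum>b\<in>B. green \<alpha> (x - b))"
        using green_nonneg[OF \<alpha>] by (intro sum_mono2) (auto simp: B_def finite_annulus)
      finally show ?thesis by simp
    qed
    have upper: "(\<Sum>b\<in>B. green \<alpha> (a - b)) \<le> 5 * C * N * s" if "a \<in> B" for a
    proof -
      have "(\<Sum>b\<in>B. green \<alpha> (a - b)) \<le> C * (\<Sum>b\<in>B. riesz \<alpha> (maxnorm (a - b)))"
        unfolding sum_distrib_left by (intro sum_mono C(2))
      also have "\<dots> \<le> C * (real N * (3 + 2 * s))"
        using riesz_interaction_le[OF \<alpha>(2) sl inf N(2)] that C(1) by (intro mult_left_mono) (auto simp: B_def s_def)
      \<comment> \<open>Here s \<ge> 1 turns the additive constant 3 into a multiple of s, so that s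
        can be cancelled later.\<close>
      also have "\<dots> \<le> C * (real N * (5 * s))" using C(1) s(1) by (intro mult_left_mono) auto
      finally show ?thesis by (simp add: mult_ac)
    qed
    have "c * s / 2 \<le> (5 * C * N * s) * enn2real (hit (stable_step \<alpha>) B x)"
    proof (rule order_trans[OF lower green_potential_le_hit[OF \<alpha> _ upper]])
      show "finite B" by (simp add: B_def finite_annulus)
      show "0 \<le> 5 * C * N * s" using C(1) s(1) by simp
    qed
    then have "s * (c / 2) \<le> s * (5 * C * N * enn2real (hit (stable_step \<alpha>) B x))" by (simp add: mult_ac)
    then have "c / 2 \<le> 5 * C * N * enn2real (hit (stable_step \<alpha>) B x)"
      using s(1) by (subst (asm) mult_le_cancel_left_pos) auto
    then have "c / (10 * C * N) \<le> enn2real (hit (stable_step \<alpha>) B x)"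
      using C(1) N(1) by (simp add: field_simps)
    then have "ennreal (c / (10 * C * N)) \<le> ennreal (enn2real (hit (stable_step \<alpha>) B x))"
      by (rule ennreal_leI)
    also have "\<dots> = hit (stable_step \<alpha>) B x"
      using hit_le_1[of "stable_step \<alpha>" B x] by (auto simp: ennreal_enn2real_if top_unique)
    also have "\<dots> \<le> hit (stable_step \<alpha>) A x" by (intro hit_mono) (auto simp: B_def annulus_def)
    finally show ?thesis .
  qed
  moreover have "0 < c / (10 * C * N)" using c C N by simp
  ultimately show thesis using that by blast
qed

text \<open>The potential is taken at the origin, where the distance to a is the norm of a. The term
  a = 0, absent from the series, contributes at most C, so the rest must already be
  infinite.\<close>

lemma certain_hit_imp_riesz_infinite:
  assumes \<alpha>: "0 < \<alpha>" "\<alpha> < 2" and hit: "\<And>x. hit (stable_step \<alpha>) A x = 1"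
  shows "(\<integral>\<^sup>+ a. ennreal (1 / (real (maxnorm a) powr (2 - \<alpha>))) \<partial>count_space (A - {(0, 0)})) = \<infinity>"
proof -
  obtain C where C: "0 < C" "\<And>z. green \<alpha> z \<le> C * riesz \<alpha> (maxnorm z)"
    using green_upper \<alpha> by blast
  let ?I = "\<integral>\<^sup>+ a. ennreal (1 / (real (maxnorm a) powr (2 - \<alpha>))) \<partial>count_space (A - {(0, 0)})"
  have "\<infinity> = (\<integral>\<^sup>+ a. ennreal (green \<alpha> (0 - a)) \<partial>count_space A)"
    using certain_hit_imp_potential_infinite[OF green_renewal[OF \<alpha>] hit, of 0] by simp
  also have "\<dots> \<le> (\<integral>\<^sup>+ a. ennreal C * indicator {0} a + ennreal C * (ennreal (1 / (real (maxnorm a) powr (2 - \<alpha>))) * indicator (A - {(0, 0)}) a) \<partial>count_space UNIV)"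
  proof (subst nn_integral_count_space_indicator, simp, rule nn_integral_mono)
    fix a :: pt
    have g: "green \<alpha> (0 - a) \<le> C * riesz \<alpha> (maxnorm a)"
      using C(2)[of "0 - a"] maxnorm_commute[of 0 a] by simp
    show "ennreal (green \<alpha> (0 - a)) * indicator A a \<le>
        ennreal C * indicator {0} a + ennreal C * (ennreal (1 / (real (maxnorm a) powr (2 - \<alpha>))) * indicator (A - {(0, 0)}) a)"
    proof (cases "a = 0")
      case True
      then have "ennreal (green \<alpha> (0 - a)) * indicator A a \<le> ennreal C"
        using g by (auto simp: riesz_def intro!: ennreal_leI split: split_indicator)
      then show ?thesis using True by (simp add: add_increasing2)
    next
      case False
      then have "1 \<le> maxnorm a" by (simp add: Suc_le_eq)
      then have "riesz \<alpha> (maxnorm a) = 1 / (real (maxnorm a) powr (2 - \<alpha>))"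
        using powr_minus_divide[of "real (maxnorm a)" "2 - \<alpha>"] by (simp add: riesz_def max_def)
      then show ?thesis
        using False g C(1) by (auto simp: ennreal_mult[symmetric] zero_prod_def[symmetric] intro!: ennreal_leI split: split_indicator)
    qed
  qed
  also have "\<dots> = ennreal C + ennreal C * ?I"
    by (simp add: nn_integral_add nn_integral_cmult nn_integral_count_space_indicator)
  finally show ?thesis
    by (cases ?I) (auto simp: top_unique ennreal_mult_eq_top_iff ennreal_add_eq_top)
qed

theorem theorem3p2:
  fixes \<alpha> :: real and A :: "pt set"
  assumes "1 \<le> \<alpha>" and "\<alpha> < 2"
    and "radially_bounded A" and "superlinear A"
  shows "stable_massive \<alpha> A \<longleftrightarrow>
    (\<integral>\<^sup>+ a. ennreal (1 / (real (maxnorm a) powr (2 - \<alpha>))) \<partial>count_space (A - {(0, 0)})) = \<infinity>"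
proof
  have \<alpha>: "0 < \<alpha>" using assms by simp
  {
    assume "stable_massive \<alpha> A"
    then show "(\<integral>\<^sup>+ a. ennreal (1 / (real (maxnorm a) powr (2 - \<alpha>))) \<partial>count_space (A - {(0, 0)})) = \<infinity>"
      using \<alpha> assms(2) by (intro certain_hit_imp_riesz_infinite) (auto simp: stable_massive_iff_hit)
  next
    assume "(\<integral>\<^sup>+ a. ennreal (1 / (real (maxnorm a) powr (2 - \<alpha>))) \<partial>count_space (A - {(0, 0)})) = \<infinity>"
    then have "\<And>K. \<exists>R. K \<le> riesz_sum \<alpha> A R"
      unfolding nn_integral_riesz_infinite_iff by blast
    then obtain c where c: "0 < c" "\<And>x. ennreal c \<le> hit (stable_step \<alpha>) A x"
      using hit_bounded_below[OF \<alpha> assms(2-4)] by blast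
    have "c \<le> 1" using order_trans[OF c(2) hit_le_1] by (simp add: ennreal_le_1)
    then show "stable_massive \<alpha> A"
      unfolding stable_massive_iff_hit using hit_bounded_below_imp_certain[OF c(1)] c(2) by blast
  }
qed

end
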